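(* Consider the robust perception POP described in the context (any one of its four instances), with $g=\{g_1,\dots,g_{l_g}\}$. Let $(\hat p,\hat f)$ be any candidate solution of the POP, i.e. $\hat p\in\mathcal P$ and $\hat f=f(\hat p)$. Suppose the following feasibility problem has at least one solution: find $\lambda^x_j\in\mathbb R^{m_{\tilde n}(2)}$ (one for each $h_j\in h^x$), $\lambda^\theta_j\in\mathbb R^{m_n(2)}$ (one for each $h_j\in h^\theta$), $S_0\in\mathcal S_+^{m(\mathcal B)}$ and $S_k\in\mathcal S_+^{m_{\tilde n}(1)}$, $k=1,\dots,l_g$, such that, for all $p\in\mathbb R^{\tilde n}$, $$f(p)-\hat f-\sum_{h_j\in h^x}h_j\,\big([p]_2^{\mathsf T}\lambda_j^x\big)-\sum_{h_j\in h^\theta}h_j\,\big([x]_2^{\mathsf T}\lambda_j^\theta\big)=[p]_{\mathcal B}^{\mathsf T}S_0[p]_{\mathcal B}+\sum_{k=1}^{l_g}g_k\,\big([p]_1^{\mathsf T}S_k[p]_1\big).$$ Then $\hat f$ is the global minimum and $\hat p$ is a global minimizer of the POP. Moreover, the problem of finding $\lambda^x_j\in\mathbb R^{m_{\tilde n}(2)}$ (one for each $h_j\in h^x$), $\lambda^\theta_j\in\mathbb R^{m_n(2)}$ (one for each $h_j\in h^\theta$), $S_0\in\mathcal S_+^{m(\mathcal B)}$ and $S_k\in\mathcal S_+^{m_{\tilde n}(1)}$, $k=1,\dots,l_g$, such that the polynomial identity $f(p)-\hat f-\sum_{h_j\in h^x}h_j\,([p]_2^{\mathsf T}\lambda_j^x)-\sum_{h_j\in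 h^\theta}h_j\,([x]_2^{\mathsf T}\lambda_j^\theta)=[p]_{\mathcal B}^{\mathsf T}S_0[p]_{\mathcal B}+\sum_{k=1}^{l_g}g_k\,([p]_1^{\mathsf T}S_k[p]_1)$ holds for all $p\in\mathbb R^{\tilde n}$ can be written as the feasibility SDP $$\text{find } d\quad\text{s.t.}\quad d\in\mathcal K\cap\mathcal A,$$ where $d=[(\lambda_1^x)^{\mathsf T},\dots,(\lambda^x_{|h^x|})^{\mathsf T},(\lambda_1^\theta)^{\mathsf T},\dots,(\lambda^\theta_{|h^\theta|})^{\mathsf T},\mathrm{svec}(S_1)^{\mathsf T},\dots,\mathrm{svec}(S_{l_g})^{\mathsf T},\mathrm{svec}(S_0)^{\mathsf T}]^{\mathsf T}$, $\mathcal K$ is a convex cone (encoding the positive semidefiniteness constraints), and $\mathcal A=\{d:Ad=b\}$ is an affine subspace, for a vector $b$ and a matrix $A$ satisfying the partial orthogonality property.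
   Context: Robust perception POP. $N\ge1$, $\bar c>0$, $\beta_i>0$ are given; $p=[x^{\mathsf T},\theta^{\mathsf T}]^{\mathsf T}\in\mathbb R^{\tilde n}$, $\tilde n=n+N$, $x\in\mathbb R^n$, $\theta\in\mathbb R^N$. The POP is $f^\star=\min_p f(p)$ subject to $h(p)=0$ for all $h\in h^x\cup h^\theta$ and $1\ge g_k(p)\ge0$ for all $g_k\in g$; its feasible set is $\mathcal P$. Here $$f(p)=\sum_{i=1}^N\Big(\frac{1+\theta_i}{2\beta_i^2}\rho_i(x)+\frac{1-\theta_i}{2}\bar c^2\Big),\qquad h^\theta=\{1-\theta_i^2\}_{i=1}^N,$$ and $(\rho_i,h^x,g)$ is one of the following. For a $3\times3$ matrix $R$ with columns $r_1,r_2,r_3$, let $h^r(R)$ be the 15 polynomials $1-\|r_1\|^2,1-\|r_2\|^2,1-\|r_3\|^2,r_1^{\mathsf T}r_2,r_2^{\mathsf T}r_3,r_3^{\mathsf T}r_1$ and the entries of $r_1\times r_2-r_3$, $r_2\times r_3-r_1$, $r_3\times r_1-r_2$ (they define $R\in\mathrm{SO}(3)$). - Single rotation averaging: $n=9$, $x=\mathrm{vec}(R)$, data $R_i\in\mathrm{SO}(3)$; $\rho_i=6-2\,\mathrm{vec}(R_i)^{\mathsf T}x$, $h^x=h^r(R)$, $g=\emptyset$. - Shape alignment: $n=6$, $x=[\bar r_1^{\mathsf T},\bar r_2^{\mathsf T}]^{\mathsf T}$ with $\bar r_1,\bar r_2\in\mathbb R^3$ the rows of $\bar R\in\mathbb R^{2\times3}$,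 data $B_i\in\mathbb R^3,b_i\in\mathbb R^2$, $\bar s>0$; $\rho_i=\|b_i-\bar RB_i\|^2$, $h^x=\{\|\bar r_1\|^2-\|\bar r_2\|^2,\ \bar r_1^{\mathsf T}\bar r_2\}$, $g=\{1-(\|\bar r_1\|^2+\|\bar r_2\|^2)/(2\bar s^2)\}$. - Point cloud registration: $n=12$, $x=[\mathrm{vec}(R)^{\mathsf T},t^{\mathsf T}]^{\mathsf T}$, data $a_i,b_i\in\mathbb R^3$, $T>0$; $\rho_i=\|t\|^2-2b_i^{\mathsf T}t-2b_i^{\mathsf T}Ra_i+2t^{\mathsf T}Ra_i+\|a_i\|^2+\|b_i\|^2$, $h^x=h^r(R)$, $g=\{1-\|t\|^2/T^2\}$. - Mesh registration: $n=12$, $x=[\mathrm{vec}(\tilde R)^{\mathsf T},\tilde t^{\mathsf T}]^{\mathsf T}$, data $a_i,b_i\in\mathbb R^3$, unit vectors $u_i,v_i\in\mathbb R^3$, $w_i>0$, $T>0$; $\rho_i=(u_i^{\mathsf T}\tilde Rb_i-u_i^{\mathsf T}a_i-u_i^{\mathsf T}\tilde t)^2+w_i(\|v_i\|^2+\|u_i\|^2-2u_i^{\mathsf T}\tilde Rv_i)$, $h^x=h^r(\tilde R)$, $g=\{1-\|\tilde t\|^2/T^2\}$. Monomials. $[p]_d$ (resp. $[x]_d$) is the vector of all monomials in $p$ (resp. $x$) of degree at most $d$; $m_n(d)=\binom{n+d}{d}$. $[p]_{\mathcal B}=[1,x^{\mathsf T},\theta^{\mathsf T},(x)_2^{\mathsf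 T},\theta^{\mathsf T}\otimes x^{\mathsf T}]^{\mathsf T}$, where $(x)_2$ is the vector of monomials in $x$ of degree exactly 2, and $m(\mathcal B)$ is its length. $\mathcal S^m$ (resp. $\mathcal S^m_+$) denotes the symmetric (resp. symmetric positive semidefinite) $m\times m$ real matrices. $\mathrm{svec}$ is the symmetric vectorization (stacking the upper triangular entries, off-diagonal entries multiplied by $\sqrt2$, so that $\mathrm{tr}(XY)=\mathrm{svec}(X)^{\mathsf T}\mathrm{svec}(Y)$). Partial orthogonality of $A$: writing $A=[A_1,A_2,A_3]$ for the column partition according to the blocks of $d$ consisting of all the $\lambda$'s, of $\mathrm{svec}(S_1),\dots,\mathrm{svec}(S_{l_g})$, and of $\mathrm{svec}(S_0)$ respectively, $A_3A_3^{\mathsf T}$ is an invertible diagonal matrix. *)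

theory Defs
  imports Complex_Main "Jordan_Normal_Form.Matrix" "Jordan_Normal_Form.Determinant"
begin

section \<open>Monomial vectors and symmetric vectorization\<close>

text \<open>Exponent lists of length \<open>n\<close> with total degree exactly \<open>d\<close>; for \<open>d = 1\<close> the order is
  that of the variables.\<close>

fun exponents :: "nat \<Rightarrow> nat \<Rightarrow> nat list list" where
  "exponents 0 d = (if d = 0 then [[]] else [])"
| "exponents (Suc n) d =
     concat (map (\<lambda>k. map ((#) k) (exponents n (d - k))) (rev [0..<Suc d]))"

definition monomial :: "real vec \<Rightarrow> nat list \<Rightarrow> real" where
  "monomial p \<alpha> = (\<Prod>i<length \<alpha>. p $ i ^ (\<alpha> ! i))"

definition monomials_eq :: "real vec \<Rightarrow> nat \<Rightarrow> real vec" where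
  "monomials_eq p d = vec_of_list (map (monomial p) (exponents (dim_vec p) d))"

definition monomials_le :: "real vec \<Rightarrow> nat \<Rightarrow> real vec" where
  "monomials_le p d =
     vec_of_list (map (monomial p) (concat (map (exponents (dim_vec p)) [0..<Suc d])))"

definition m_dim :: "nat \<Rightarrow> nat \<Rightarrow> nat" where
  "m_dim n d = (n + d) choose d"

definition kron_vec :: "real vec \<Rightarrow> real vec \<Rightarrow> real vec" where
  "kron_vec a b = vec (dim_vec a * dim_vec b) (\<lambda>k. a $ (k div dim_vec b) * b $ (k mod dim_vec b))"

definition basis_B :: "real vec \<Rightarrow> real vec \<Rightarrow> real vec" where
  "basis_B x \<theta> =
     vec_of_list [1] @\<^sub>v x @\<^sub>v \<theta> @\<^sub>v monomials_eq x 2 @\<^sub>v kron_vec \<theta> x"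

definition mB_dim :: "nat \<Rightarrow> nat \<Rightarrow> nat" where
  "mB_dim n N = 1 + n + N + ((n + 1) choose 2) + N * n"

definition sym_mats :: "nat \<Rightarrow> real mat set" where
  "sym_mats m = {S \<in> carrier_mat m m. S\<^sup>T = S}"

definition psd_mats :: "nat \<Rightarrow> real mat set" where
  "psd_mats m = {S \<in> sym_mats m. \<forall>v \<in> carrier_vec m. v \<bullet> (S *\<^sub>v v) \<ge> 0}"

definition svec :: "real mat \<Rightarrow> real vec" where
  "svec S = vec_of_list (concat (map (\<lambda>j. map (\<lambda>i. if i = j then S $$ (i, j) else sqrt 2 * S $$ (i, j))
     [0..<Suc j]) [0..<dim_row S]))"

definition svec_dim :: "nat \<Rightarrow> nat" where
  "svec_dim m = m * (m + 1) div 2"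

definition concat_vecs :: "real vec list \<Rightarrow> real vec" where
  "concat_vecs vs = foldr (@\<^sub>v) vs vNil"

text \<open>The lengths above agree with the lengths of the vectors they are meant to measure, and
  \<open>svec\<close> is an isometry for the trace inner product.\<close>

lemma sum_list_upt_Suc: "(\<Sum>k\<leftarrow>[0..<Suc d]. f k) = (\<Sum>k\<le>d. f k)"
  for f :: "nat \<Rightarrow> 'a :: comm_monoid_add"
  by (simp only: interv_sum_list_conv_sum_set_nat atLeast0LessThan lessThan_Suc_atMost set_upt)

lemma length_exponents_Suc:
  "length (exponents (Suc n) d) = (n + d) choose d"
proof (induction n arbitrary: d)
  case 0
  have "concat (map (\<lambda>k. map ((#) k) (if d - k = 0 then [[]] else [])) (rev [0..<d])) = []"
    by auto
  then show ?case by simp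
next
  case (Suc n)
  have "length (exponents (Suc (Suc n)) d)
      = (\<Sum>k\<leftarrow>rev [0..<Suc d]. length (exponents (Suc n) (d - k)))"
    by (subst exponents.simps(2)) (simp only: length_concat map_map comp_def length_map)
  also have "\<dots> = (\<Sum>k\<leftarrow>[0..<Suc d]. (n + (d - k)) choose (d - k))"
    unfolding Suc.IH rev_map[symmetric] by simp
  also have "\<dots> = (\<Sum>k=0..d. (n + (d - k)) choose (d - k))"
    by (simp only: sum_list_upt_Suc atLeast0AtMost)
  also have "\<dots> = (\<Sum>k\<le>d. (n + k) choose k)"
    by (rule sum.reindex_bij_witness[of _ "\<lambda>k. d - k" "\<lambda>k. d - k"]) auto
  also have "\<dots> = (Suc n + d) choose d"
    by (simp add: sum_choose_lower)
  finally show ?case .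
qed

lemma dim_monomials_le: "dim_vec (monomials_le p d) = m_dim (dim_vec p) d"
proof (cases "dim_vec p")
  case 0
  have "length (concat (map (exponents 0) [0..<Suc d])) = 1"
    by (induction d) auto
  with 0 show ?thesis by (simp add: monomials_le_def m_dim_def del: exponents.simps upt_Suc)
next
  case (Suc n)
  have "length (concat (map (exponents (Suc n)) [0..<Suc d])) = (\<Sum>k\<le>d. (n + k) choose k)"
    unfolding length_concat map_map comp_def length_exponents_Suc
    by (simp only: sum_list_upt_Suc)
  with Suc show ?thesis
    by (simp add: monomials_le_def m_dim_def sum_choose_lower del: exponents.simps upt_Suc)
qed

lemma dim_basis_B: "dim_vec (basis_B x \<theta>) = mB_dim (dim_vec x) (dim_vec \<theta>)"
proof -
  have "length (exponents n 2) = (n + 1) choose 2" for n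
    by (cases n) (simp_all add: length_exponents_Suc del: exponents.simps(2))
  then show ?thesis
    by (simp add: basis_B_def mB_dim_def monomials_eq_def kron_vec_def)
qed

lemma dim_svec: "dim_vec (svec S) = svec_dim (dim_row S)"
proof -
  have "(\<Sum>j\<leftarrow>[0..<m]. Suc j) = svec_dim m" for m
    by (induction m) (simp_all add: svec_dim_def)
  then show ?thesis
    by (simp add: svec_def length_concat comp_def del: upt_Suc)
qed

lemma svec_scalar_prod:
  assumes "X \<in> sym_mats m" "Y \<in> sym_mats m"
  shows "(\<Sum>i<m. (X * Y) $$ (i, i)) = svec X \<bullet> svec Y"
proof -
  define e where "e S i j = (if i = j then S $$ (i, j) else sqrt 2 * S $$ (i, j))"
    for S :: "real mat" and i j
  define L where "L S k = concat (map (\<lambda>j. map (\<lambda>i. e S i j) [0..<Suc j]) [0..<k])" for S k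
  have sv: "svec S = vec_of_list (L S (dim_row S))" for S
    by (simp only: svec_def L_def e_def)
  have len: "length (L X k) = length (L Y k)" for k
    by (simp add: L_def length_concat comp_def)
  have dims: "X \<in> carrier_mat m m" "Y \<in> carrier_mat m m"
    using assms by (auto simp: sym_mats_def)
  have sX: "X $$ (i, j) = X $$ (j, i)" if "i < m" "j < m" for i j
    using assms(1) that unfolding sym_mats_def by (metis (mono_tags, lifting) carrier_matD index_transpose_mat(1) mem_Collect_eq)
  have sY: "Y $$ (i, j) = Y $$ (j, i)" if "i < m" "j < m" for i j
    using assms(2) that unfolding sym_mats_def by (metis (mono_tags, lifting) carrier_matD index_transpose_mat(1) mem_Collect_eq)
  have zipmap: "zip (concat (map f ks)) (concat (map g ks)) = concat (map (\<lambda>k. zip (f k) (g k)) ks)"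
    if "\<And>k. length (f k) = length (g k)" for f g :: "nat \<Rightarrow> real list" and ks
    using that by (induction ks) auto
  have sp: "vec_of_list xs \<bullet> vec_of_list ys = (\<Sum>(x, y)\<leftarrow>zip xs ys. x * y)"
    if "length xs = length ys" for xs ys :: "real list"
    using that
    by (simp add: scalar_prod_def sum_list_sum_nth vec_of_list_index)
  have "svec X \<bullet> svec Y = (\<Sum>(x, y)\<leftarrow>zip (L X m) (L Y m). x * y)"
    using dims sp[OF len] by (auto simp: sv)
  also have "\<dots> = (\<Sum>j<m. \<Sum>i\<le>j. e X i j * e Y i j)"
  proof (induction m)
    case 0
    show ?case by (simp add: L_def)
  next
    case (Suc k)
    have LS: "L S (Suc k) = L S k @ map (\<lambda>i. e S i k) [0..<Suc k]" for S
      by (simp add: L_def del: upt_Suc) (simp add: upt_Suc)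
    have "(\<Sum>(x, y)\<leftarrow>zip (map (\<lambda>i. e X i k) [0..<Suc k]) (map (\<lambda>i. e Y i k) [0..<Suc k]). x * y)
       = (\<Sum>i\<leftarrow>[0..<Suc k]. e X i k * e Y i k)"
      by (simp only: zip_map_map zip_same_conv_map map_map comp_def split)
    also have "\<dots> = (\<Sum>i\<le>k. e X i k * e Y i k)"
      by (simp only: sum_list_upt_Suc)
    finally show ?case using Suc len[of k] by (simp add: LS del: upt_Suc)
  qed
  also have "\<dots> = (\<Sum>j<m. \<Sum>i<m. X $$ (i, j) * Y $$ (j, i))"
  proof -
    have *: "(\<Sum>j<k. \<Sum>i\<le>j. e X i j * e Y i j) = (\<Sum>j<k. \<Sum>i<k. X $$ (i, j) * Y $$ (j, i))"
      if "k \<le> m" for k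
      using that
    proof (induction k)
      case (Suc k)
      have "(\<Sum>i\<le>k. e X i k * e Y i k) = X $$ (k, k) * Y $$ (k, k) + (\<Sum>i<k. 2 * (X $$ (i, k) * Y $$ (i, k)))"
      proof -
        have "(\<Sum>i<k. e X i k * e Y i k) = (\<Sum>i<k. 2 * (X $$ (i, k) * Y $$ (i, k)))"
          by (intro sum.cong refl) (simp add: e_def mult.left_commute mult.assoc[symmetric])
        then show ?thesis by (simp add: lessThan_Suc_atMost[symmetric] e_def)
      qed
      also have "(\<Sum>i<k. 2 * (X $$ (i, k) * Y $$ (i, k)))
        = (\<Sum>i<k. X $$ (i, k) * Y $$ (k, i)) + (\<Sum>j<k. X $$ (k, j) * Y $$ (j, k))"
        unfolding sum.distrib[symmetric] using Suc.prems
        by (intro sum.cong refl) (simp add: sX[of _ k] sY[of _ k])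
      finally show ?case using Suc by (simp add: sum.distrib)
    qed simp
    show ?thesis by (rule *) simp
  qed
  also have "\<dots> = (\<Sum>i<m. (X * Y) $$ (i, i))"
    using dims
    by (subst sum.swap) (auto simp: scalar_prod_def atLeast0LessThan intro!: sum.cong)
  finally show ?thesis by simp
qed


section \<open>Robust perception problems\<close>

abbreviation sqn :: "real vec \<Rightarrow> real" where
  "sqn v \<equiv> v \<bullet> v"

definition cross :: "real vec \<Rightarrow> real vec \<Rightarrow> real vec" where
  "cross a b = vec_of_list
     [a $ 1 * b $ 2 - a $ 2 * b $ 1, a $ 2 * b $ 0 - a $ 0 * b $ 2, a $ 0 * b $ 1 - a $ 1 * b $ 0]"

definition SO3 :: "real mat set" where
  "SO3 = {R \<in> carrier_mat 3 3. R\<^sup>T * R = 1\<^sub>m 3 \<and> det R = 1}"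

text \<open>Column-stacking vectorization of a three by three matrix, and its inverse.\<close>

definition vec3 :: "real mat \<Rightarrow> real vec" where
  "vec3 R = col R 0 @\<^sub>v col R 1 @\<^sub>v col R 2"

definition unvec3 :: "real vec \<Rightarrow> real mat" where
  "unvec3 x = mat 3 3 (\<lambda>(i, j). x $ (3 * j + i))"

definition h_rot :: "(real mat \<Rightarrow> real) list" where
  "h_rot =
     [\<lambda>R. 1 - sqn (col R 0), \<lambda>R. 1 - sqn (col R 1), \<lambda>R. 1 - sqn (col R 2),
      \<lambda>R. col R 0 \<bullet> col R 1, \<lambda>R. col R 1 \<bullet> col R 2, \<lambda>R. col R 2 \<bullet> col R 0]
     @ map (\<lambda>i R. (cross (col R 0) (col R 1) - col R 2) $ i) [0..<3]
     @ map (\<lambda>i R. (cross (col R 1) (col R 2) - col R 0) $ i) [0..<3]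
     @ map (\<lambda>i R. (cross (col R 2) (col R 0) - col R 1) $ i) [0..<3]"

text \<open>The arguments are: the measured rotations; the points \<open>B\<close>, \<open>b\<close> and the scale bound;
  the points \<open>a\<close>, \<open>b\<close> and the translation bound; the points \<open>a\<close>, \<open>b\<close>, the normals
  \<open>u\<close>, \<open>v\<close>, the weights \<open>w\<close> and the translation bound. Indices range over \<open>{0..<N}\<close>.\<close>

datatype perception =
    RotationAveraging "nat \<Rightarrow> real mat"
  | ShapeAlignment "nat \<Rightarrow> real vec" "nat \<Rightarrow> real vec" real
  | PointCloudRegistration "nat \<Rightarrow> real vec" "nat \<Rightarrow> real vec" real
  | MeshRegistration "nat \<Rightarrow> real vec" "nat \<Rightarrow> real vec" "nat \<Rightarrow> real vec" "nat \<Rightarrow> real vec"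
      "nat \<Rightarrow> real" real

fun valid_data :: "nat \<Rightarrow> perception \<Rightarrow> bool" where
  "valid_data N (RotationAveraging Rs) = (\<forall>i<N. Rs i \<in> SO3)"
| "valid_data N (ShapeAlignment B b s) =
     ((\<forall>i<N. B i \<in> carrier_vec 3 \<and> b i \<in> carrier_vec 2) \<and> s > 0)"
| "valid_data N (PointCloudRegistration a b T) =
     ((\<forall>i<N. a i \<in> carrier_vec 3 \<and> b i \<in> carrier_vec 3) \<and> T > 0)"
| "valid_data N (MeshRegistration a b u v w T) =
     ((\<forall>i<N. a i \<in> carrier_vec 3 \<and> b i \<in> carrier_vec 3 \<and>
         u i \<in> carrier_vec 3 \<and> sqn (u i) = 1 \<and> v i \<in> carrier_vec 3 \<and> sqn (v i) = 1 \<and> w i > 0)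
      \<and> T > 0)"

fun x_dim :: "perception \<Rightarrow> nat" where
  "x_dim (RotationAveraging Rs) = 9"
| "x_dim (ShapeAlignment B b s) = 6"
| "x_dim (PointCloudRegistration a b T) = 12"
| "x_dim (MeshRegistration a b u v w T) = 12"

fun \<rho> :: "perception \<Rightarrow> nat \<Rightarrow> real vec \<Rightarrow> real" where
  "\<rho> (RotationAveraging Rs) i x = 6 - 2 * (vec3 (Rs i) \<bullet> x)"
| "\<rho> (ShapeAlignment B b s) i x =
     (let R = mat_of_rows 3 [vec_first x 3, vec_last x 3] in sqn (b i - R *\<^sub>v B i))"
| "\<rho> (PointCloudRegistration a b T) i x =
     (let R = unvec3 (vec_first x 9); t = vec_last x 3 in
      sqn t - 2 * (b i \<bullet> t) - 2 * (b i \<bullet> (R *\<^sub>v a i)) + 2 * (t \<bullet> (R *\<^sub>v a i))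
        + sqn (a i) + sqn (b i))"
| "\<rho> (MeshRegistration a b u v w T) i x =
     (let R = unvec3 (vec_first x 9); t = vec_last x 3 in
      (u i \<bullet> (R *\<^sub>v b i) - u i \<bullet> a i - u i \<bullet> t)\<^sup>2
        + w i * (sqn (v i) + sqn (u i) - 2 * (u i \<bullet> (R *\<^sub>v v i))))"

fun hx :: "perception \<Rightarrow> (real vec \<Rightarrow> real) list" where
  "hx (RotationAveraging Rs) = map (\<lambda>h x. h (unvec3 x)) h_rot"
| "hx (ShapeAlignment B b s) =
     [\<lambda>x. sqn (vec_first x 3) - sqn (vec_last x 3), \<lambda>x. vec_first x 3 \<bullet> vec_last x 3]"
| "hx (PointCloudRegistration a b T) = map (\<lambda>h x. h (unvec3 (vec_first x 9))) h_rot"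
| "hx (MeshRegistration a b u v w T) = map (\<lambda>h x. h (unvec3 (vec_first x 9))) h_rot"

fun gs :: "perception \<Rightarrow> (real vec \<Rightarrow> real) list" where
  "gs (RotationAveraging Rs) = []"
| "gs (ShapeAlignment B b s) =
     [\<lambda>x. 1 - (sqn (vec_first x 3) + sqn (vec_last x 3)) / (2 * s\<^sup>2)]"
| "gs (PointCloudRegistration a b T) = [\<lambda>x. 1 - sqn (vec_last x 3) / T\<^sup>2]"
| "gs (MeshRegistration a b u v w T) = [\<lambda>x. 1 - sqn (vec_last x 3) / T\<^sup>2]"

definition h\<theta> :: "nat \<Rightarrow> (real vec \<Rightarrow> real) list" where
  "h\<theta> N = map (\<lambda>i \<theta>. 1 - (\<theta> $ i)\<^sup>2) [0..<N]"

definition p_dim :: "nat \<Rightarrow> perception \<Rightarrow> nat" where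
  "p_dim N I = x_dim I + N"

definition x_part :: "perception \<Rightarrow> real vec \<Rightarrow> real vec" where
  "x_part I p = vec_first p (x_dim I)"

definition \<theta>_part :: "nat \<Rightarrow> real vec \<Rightarrow> real vec" where
  "\<theta>_part N p = vec_last p N"

definition objective :: "nat \<Rightarrow> (nat \<Rightarrow> real) \<Rightarrow> real \<Rightarrow> perception \<Rightarrow> real vec \<Rightarrow> real" where
  "objective N \<beta> c I p =
     (\<Sum>i<N. (1 + \<theta>_part N p $ i) / (2 * (\<beta> i)\<^sup>2) * \<rho> I i (x_part I p)
            + (1 - \<theta>_part N p $ i) / 2 * c\<^sup>2)"

definition feasible_set :: "nat \<Rightarrow> perception \<Rightarrow> real vec set" where
  "feasible_set N I = {p \<in> carrier_vec (p_dim N I).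
     (\<forall>h \<in> set (hx I). h (x_part I p) = 0) \<and> (\<forall>h \<in> set (h\<theta> N). h (\<theta>_part N p) = 0) \<and>
     (\<forall>g \<in> set (gs I). 1 \<ge> g (x_part I p) \<and> g (x_part I p) \<ge> 0)}"


section \<open>Sum-of-squares certificates\<close>

text \<open>The unknowns are lists \<open>\<Lambda>x\<close>, \<open>\<Lambda>\<theta>\<close> of multiplier vectors, the list \<open>Ss\<close> of the
  matrices attached to the inequality constraints, and the matrix \<open>S0\<close>.\<close>

definition certificate_shape ::
  "nat \<Rightarrow> perception \<Rightarrow> real vec list \<Rightarrow> real vec list \<Rightarrow> real mat list \<Rightarrow> real mat \<Rightarrow> bool" where
  "certificate_shape N I \<Lambda>x \<Lambda>\<theta> Ss S0 \<longleftrightarrow>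
     length \<Lambda>x = length (hx I) \<and> set \<Lambda>x \<subseteq> carrier_vec (m_dim (p_dim N I) 2) \<and>
     length \<Lambda>\<theta> = length (h\<theta> N) \<and> set \<Lambda>\<theta> \<subseteq> carrier_vec (m_dim (x_dim I) 2) \<and>
     length Ss = length (gs I) \<and> set Ss \<subseteq> sym_mats (m_dim (p_dim N I) 1) \<and>
     S0 \<in> sym_mats (mB_dim (x_dim I) N)"

definition certificate_psd :: "nat \<Rightarrow> perception \<Rightarrow> real mat list \<Rightarrow> real mat \<Rightarrow> bool" where
  "certificate_psd N I Ss S0 \<longleftrightarrow>
     set Ss \<subseteq> psd_mats (m_dim (p_dim N I) 1) \<and> S0 \<in> psd_mats (mB_dim (x_dim I) N)"

definition certificate_identity ::
  "nat \<Rightarrow> (nat \<Rightarrow> real) \<Rightarrow> real \<Rightarrow> perception \<Rightarrow> real \<Rightarrow>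
   real vec list \<Rightarrow> real vec list \<Rightarrow> real mat list \<Rightarrow> real mat \<Rightarrow> bool" where
  "certificate_identity N \<beta> c I fhat \<Lambda>x \<Lambda>\<theta> Ss S0 \<longleftrightarrow>
     (\<forall>p \<in> carrier_vec (p_dim N I).
        let x = x_part I p; \<theta> = \<theta>_part N p; q = monomials_le p 1; qB = basis_B x \<theta> in
        objective N \<beta> c I p - fhat
          - (\<Sum>j<length (hx I). (hx I ! j) x * (monomials_le p 2 \<bullet> (\<Lambda>x ! j)))
          - (\<Sum>j<length (h\<theta> N). (h\<theta> N ! j) \<theta> * (monomials_le x 2 \<bullet> (\<Lambda>\<theta> ! j)))
        = qB \<bullet> (S0 *\<^sub>v qB)
          + (\<Sum>k<length (gs I). (gs I ! k) x * (q \<bullet> ((Ss ! k) *\<^sub>v q))))"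

definition is_certificate ::
  "nat \<Rightarrow> (nat \<Rightarrow> real) \<Rightarrow> real \<Rightarrow> perception \<Rightarrow> real \<Rightarrow>
   real vec list \<Rightarrow> real vec list \<Rightarrow> real mat list \<Rightarrow> real mat \<Rightarrow> bool" where
  "is_certificate N \<beta> c I fhat \<Lambda>x \<Lambda>\<theta> Ss S0 \<longleftrightarrow>
     certificate_shape N I \<Lambda>x \<Lambda>\<theta> Ss S0 \<and> certificate_psd N I Ss S0 \<and>
     certificate_identity N \<beta> c I fhat \<Lambda>x \<Lambda>\<theta> Ss S0"


section \<open>The feasibility SDP\<close>

definition decision_vec ::
  "real vec list \<Rightarrow> real vec list \<Rightarrow> real mat list \<Rightarrow> real mat \<Rightarrow> real vec" where
  "decision_vec \<Lambda>x \<Lambda>\<theta> Ss S0 = concat_vecs (\<Lambda>x @ \<Lambda>\<theta> @ map svec Ss @ [svec S0])"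

definition block1_dim :: "nat \<Rightarrow> perception \<Rightarrow> nat" where
  "block1_dim N I =
     length (hx I) * m_dim (p_dim N I) 2 + length (h\<theta> N) * m_dim (x_dim I) 2"

definition block2_dim :: "nat \<Rightarrow> perception \<Rightarrow> nat" where
  "block2_dim N I = length (gs I) * svec_dim (m_dim (p_dim N I) 1)"

definition block3_dim :: "nat \<Rightarrow> perception \<Rightarrow> nat" where
  "block3_dim N I = svec_dim (mB_dim (x_dim I) N)"

definition decision_dim :: "nat \<Rightarrow> perception \<Rightarrow> nat" where
  "decision_dim N I = block1_dim N I + block2_dim N I + block3_dim N I"

definition sdp_cone :: "nat \<Rightarrow> perception \<Rightarrow> real vec set" where
  "sdp_cone N I = {decision_vec \<Lambda>x \<Lambda>\<theta> Ss S0 | \<Lambda>x \<Lambda>\<theta> Ss S0.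
     certificate_shape N I \<Lambda>x \<Lambda>\<theta> Ss S0 \<and> certificate_psd N I Ss S0}"

definition is_convex_cone :: "nat \<Rightarrow> real vec set \<Rightarrow> bool" where
  "is_convex_cone n K \<longleftrightarrow> K \<noteq> {} \<and> K \<subseteq> carrier_vec n \<and>
     (\<forall>v\<in>K. \<forall>r\<ge>0. r \<cdot>\<^sub>v v \<in> K) \<and>
     (\<forall>v\<in>K. \<forall>w\<in>K. \<forall>s\<ge>0. \<forall>t\<ge>0. s + t = 1 \<longrightarrow> s \<cdot>\<^sub>v v + t \<cdot>\<^sub>v w \<in> K)"

definition affine_space :: "nat \<Rightarrow> real mat \<Rightarrow> real vec \<Rightarrow> real vec set" where
  "affine_space n A b = {d \<in> carrier_vec n. A *\<^sub>v d = b}"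

definition col_block :: "real mat \<Rightarrow> nat \<Rightarrow> nat \<Rightarrow> real mat" where
  "col_block A k l = mat (dim_row A) l (\<lambda>(i, j). A $$ (i, k + j))"

definition partially_orthogonal :: "nat \<Rightarrow> nat \<Rightarrow> nat \<Rightarrow> real mat \<Rightarrow> bool" where
  "partially_orthogonal l1 l2 l3 A \<longleftrightarrow> dim_col A = l1 + l2 + l3 \<and>
     (let A3 = col_block A (l1 + l2) l3 in
      diagonal_mat (A3 * A3\<^sup>T) \<and> invertible_mat (A3 * A3\<^sup>T))"

end

theory Submission
  imports Defs
begin

text \<open>On feasible points the multiplier terms of the identity vanish and the remaining right-hand side
  is nonnegative, so a certificate bounds the objective below by \<open>fhat\<close>.

  For the SDP, let \<open>q\<close> be the basis \<open>[p]\<^sub>B\<close> and \<open>W p = svec (q q\<^sup>T)\<close>, so that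
  \<open>q\<^sup>T S\<^sub>0 q = W p \<bullet> svec S\<^sub>0\<close>. All the other terms of the identity have total degree at most four and
  degree at most two in \<open>\<theta>\<close>, and every such monomial is a product of two entries of \<open>q\<close>; hence their
  coefficient functions have the form \<open>W p \<bullet> c\<close>, and the identity says that a vector depending affinely
  on \<open>d\<close> annihilates every \<open>W p\<close>. Testing against an orthogonal basis of the span of the vectors \<open>W p\<close>
  gives a linear system whose last column block has nonzero, pairwise orthogonal rows. Choosing the
  rows this way, instead of one row per monomial, avoids the linear independence of monomial
  functions.\<close>

section \<open>Linear systems with orthogonal rows\<close>

text \<open>No entry of \<open>basis_B\<close> contains two \<theta>-variables. Products of two
  entries therefore reach every monomial of total degree at most four and \<theta>-degree at most
  two, but nothing of \<theta>-degree three. This is why polynomials are tracked by bidegree, and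
  why it matters that the \<theta>-constraints, already quadratic in \<theta>, carry multipliers in
  x alone.

  Only the last block of d enters the annihilating vector as itself; the multipliers enter through
  fixed coefficient vectors. Pairing with an orthogonal list Q thus leaves the vectors of Q
  unchanged in the last column block of A, whose product with its transpose is the Gram matrix of Q.
  Existence of Q comes from a longest admissible orthogonal list, its length being bounded by
  Bessel's inequality.

  The cone is an image: membership of d in it only yields some data with semidefinite matrices.
  Reading semidefiniteness back from given data requires that d determines its matrices, which holds
  because the block lengths are fixed and the matrices are symmetric.\<close>

definition same_annihilator :: "nat \<Rightarrow> real vec set \<Rightarrow> real vec set \<Rightarrow> bool" where
  "same_annihilator m V W \<longleftrightarrow>
     (\<forall>d\<in>carrier_vec m. (\<forall>v\<in>V. v \<bullet> d = 0) \<longleftrightarrow> (\<forall>w\<in>W. w \<bullet> d = 0))"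

text \<open>The equivalence packs two facts: distinct members are orthogonal, and, for r = s, every
  member is nonzero. Both are needed for a Gram matrix that is diagonal and invertible.\<close>

definition orthogonal_list :: "nat \<Rightarrow> real vec list \<Rightarrow> bool" where
  "orthogonal_list m Q \<longleftrightarrow> set Q \<subseteq> carrier_vec m \<and>
     (\<forall>r<length Q. \<forall>s<length Q. Q ! r \<bullet> Q ! s = 0 \<longleftrightarrow> r \<noteq> s)"

text \<open>The Gram-Schmidt residual: w minus its orthogonal projection onto the span of Q. The
  denominators are nonzero as soon as Q is an \<open>orthogonal_list\<close>.\<close>

definition orthogonal_rest :: "nat \<Rightarrow> real vec list \<Rightarrow> real vec \<Rightarrow> real vec" where
  "orthogonal_rest m Q w =
     vec m (\<lambda>k. w $ k - (\<Sum>r<length Q. (w \<bullet> Q ! r) / (Q ! r \<bullet> Q ! r) * Q ! r $ k))"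

lemma orthogonal_rest_scalar_prod:
  assumes "d \<in> carrier_vec m" "w \<in> carrier_vec m" "set Q \<subseteq> carrier_vec m"
  shows "orthogonal_rest m Q w \<bullet> d
    = w \<bullet> d - (\<Sum>r<length Q. (w \<bullet> Q ! r) / (Q ! r \<bullet> Q ! r) * (Q ! r \<bullet> d))"
proof -
  have "(\<Sum>k<m. (\<Sum>r<length Q. (w \<bullet> Q ! r) / (Q ! r \<bullet> Q ! r) * Q ! r $ k) * d $ k)
      = (\<Sum>r<length Q. (w \<bullet> Q ! r) / (Q ! r \<bullet> Q ! r) * (\<Sum>k<m. Q ! r $ k * d $ k))"
    unfolding sum_distrib_left sum_distrib_right by (subst sum.swap) (simp add: mult.assoc)
  then show ?thesis
    using assms
    by (simp add: orthogonal_rest_def scalar_prod_def atLeast0LessThan left_diff_distrib sum_subtractf)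
qed

lemma orthogonal_rest_orthogonal:
  assumes "orthogonal_list m Q" "w \<in> carrier_vec m" "s < length Q"
  shows "orthogonal_rest m Q w \<bullet> Q ! s = 0"
proof -
  have Q: "set Q \<subseteq> carrier_vec m" and
    orth: "r < length Q \<Longrightarrow> Q ! r \<bullet> Q ! s = 0 \<longleftrightarrow> r \<noteq> s" for r
    using assms by (auto simp: orthogonal_list_def)
  have "(\<Sum>r<length Q. (w \<bullet> Q ! r) / (Q ! r \<bullet> Q ! r) * (Q ! r \<bullet> Q ! s))
      = (\<Sum>r<length Q. if r = s then w \<bullet> Q ! s else 0)"
    using orth by (intro sum.cong) auto
  then show ?thesis
    using Q assms(2,3) by (subst orthogonal_rest_scalar_prod) auto
qed

text \<open>The residual v has nonnegative squared norm. Expanding one factor of it gives the scalar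
  product of w and v, since v is orthogonal to Q; expanding the other gives the difference of the
  two sides.\<close>

lemma bessel:
  assumes "orthogonal_list m Q" "w \<in> carrier_vec m"
  shows "(\<Sum>r<length Q. (w \<bullet> Q ! r)\<^sup>2 / (Q ! r \<bullet> Q ! r)) \<le> w \<bullet> w"
proof -
  let ?v = "orthogonal_rest m Q w"
  have Q: "set Q \<subseteq> carrier_vec m" and v: "?v \<in> carrier_vec m"
    using assms by (auto simp: orthogonal_list_def orthogonal_rest_def)
  have Qr: "Q ! r \<in> carrier_vec m" if "r < length Q" for r using Q that by auto
  have "0 \<le> ?v \<bullet> ?v"
    by (simp add: scalar_prod_def sum_nonneg)
  also have "?v \<bullet> ?v = w \<bullet> ?v - (\<Sum>r<length Q. (w \<bullet> Q ! r) / (Q ! r \<bullet> Q ! r) * (Q ! r \<bullet> ?v))"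
    by (rule orthogonal_rest_scalar_prod[OF v assms(2) Q])
  also have "\<dots> = w \<bullet> ?v"
    using orthogonal_rest_orthogonal[OF assms] v Qr by (simp add: comm_scalar_prod[OF _ v])
  also have "\<dots> = ?v \<bullet> w"
    by (rule comm_scalar_prod[OF assms(2) v])
  also have "\<dots> = w \<bullet> w - (\<Sum>r<length Q. (w \<bullet> Q ! r)\<^sup>2 / (Q ! r \<bullet> Q ! r))"
  proof -
    have "(w \<bullet> Q ! r) / (Q ! r \<bullet> Q ! r) * (Q ! r \<bullet> w) = (w \<bullet> Q ! r)\<^sup>2 / (Q ! r \<bullet> Q ! r)"
      if "r < length Q" for r
      using comm_scalar_prod[OF assms(2) Qr[OF that]] by (simp add: power2_eq_square)
    then show ?thesis
      unfolding orthogonal_rest_scalar_prod[OF assms(2,2) Q]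
      by (intro arg_cong2[where f = minus] sum.cong refl) (simp only: lessThan_iff)
  qed
  finally show ?thesis by simp
qed

text \<open>Each normalised member of Q has total squared length 1, so the length of Q is a double
  sum over members and coordinates. After swapping the sums, Bessel's inequality for the i-th unit
  vector bounds the contribution of coordinate i by 1.\<close>

lemma length_orthogonal_list:
  assumes "orthogonal_list m Q"
  shows "length Q \<le> m"
proof -
  have Qr: "Q ! r \<in> carrier_vec m" "Q ! r \<bullet> Q ! r \<noteq> 0" if "r < length Q" for r
    using assms that by (auto simp: orthogonal_list_def)
  have "real (length Q) = (\<Sum>r<length Q. (\<Sum>i<m. (Q ! r $ i)\<^sup>2) / (Q ! r \<bullet> Q ! r))"
  proof -
    have one: "(\<Sum>i<m. (Q ! r $ i)\<^sup>2) / (Q ! r \<bullet> Q ! r) = 1" if "r < length Q" for r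
    proof -
      have "(\<Sum>i<m. (Q ! r $ i)\<^sup>2) = Q ! r \<bullet> Q ! r"
        using Qr(1)[OF that] by (simp add: scalar_prod_def power2_eq_square atLeast0LessThan)
      then show ?thesis using Qr(2)[OF that] by simp
    qed
    have "(\<Sum>r<length Q. (\<Sum>i<m. (Q ! r $ i)\<^sup>2) / (Q ! r \<bullet> Q ! r)) = (\<Sum>r<length Q. 1)"
      by (intro sum.cong refl one) simp
    then show ?thesis by simp
  qed
  also have "\<dots> = (\<Sum>i<m. \<Sum>r<length Q. (unit_vec m i \<bullet> Q ! r)\<^sup>2 / (Q ! r \<bullet> Q ! r))"
    unfolding sum_divide_distrib by (subst sum.swap) (use Qr in simp)
  also have "\<dots> \<le> (\<Sum>i<m. unit_vec m i \<bullet> (unit_vec m i :: real vec))"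
    by (intro sum_mono bessel[OF assms]) simp
  also have "\<dots> = real m" by simp
  finally show ?thesis by simp
qed

text \<open>An orthogonal basis of the span of W, with the span expressed through annihilators. A
  nonzero residual of some member of W would extend a longest admissible list, so all residuals
  vanish.\<close>

lemma obtain_orthogonal_list_same_annihilator:
  assumes "W \<subseteq> carrier_vec m"
  obtains Q where "orthogonal_list m Q" "same_annihilator m (set Q) W"
proof -
  \<comment> \<open>The second conjunct keeps Q inside the double annihilator of W, that is, inside
    its span. Without it a longest orthogonal list could leave the span.\<close>
  define ok where "ok Q \<longleftrightarrow> orthogonal_list m Q \<and>
    (\<forall>d\<in>carrier_vec m. (\<forall>w\<in>W. w \<bullet> d = 0) \<longrightarrow> (\<forall>q\<in>set Q. q \<bullet> d = 0))" for Q
  have "ok []" by (simp add: ok_def orthogonal_list_def)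
  moreover have "\<forall>Q. ok Q \<longrightarrow> length Q < Suc m"
    using length_orthogonal_list by (auto simp: ok_def less_Suc_eq_le)
  ultimately obtain Q where okQ: "ok Q" and max: "\<And>Q'. ok Q' \<Longrightarrow> length Q' \<le> length Q"
    using ex_has_greatest_nat[of ok "[]" length "Suc m"] by metis
  have Q: "orthogonal_list m Q" "set Q \<subseteq> carrier_vec m"
    using okQ by (auto simp: ok_def orthogonal_list_def)
  have rest0: "orthogonal_rest m Q w = 0\<^sub>v m" if "w \<in> W" for w
  proof (rule ccontr)
    let ?v = "orthogonal_rest m Q w"
    assume "?v \<noteq> 0\<^sub>v m"
    have w: "w \<in> carrier_vec m" using that assms by auto
    have v: "?v \<in> carrier_vec m" by (simp add: orthogonal_rest_def)
    have "?v \<bullet> ?v \<noteq> 0"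
    proof
      assume "?v \<bullet> ?v = 0"
      then have "\<forall>i\<in>{0..<m}. ?v $ i * ?v $ i = 0"
        using v by (subst (asm) scalar_prod_def, subst (asm) sum_nonneg_eq_0_iff) auto
      with v \<open>?v \<noteq> 0\<^sub>v m\<close> show False by (auto intro: eq_vecI)
    qed
    moreover have "?v \<bullet> Q ! s = 0" "Q ! s \<bullet> ?v = 0" if "s < length Q" for s
    proof -
      show "?v \<bullet> Q ! s = 0" by (rule orthogonal_rest_orthogonal[OF Q(1) w that])
      then show "Q ! s \<bullet> ?v = 0"
        using comm_scalar_prod[OF v, of "Q ! s"] Q(2) nth_mem[OF that] by auto
    qed
    ultimately have "orthogonal_list m (?v # Q)"
      using Q v by (auto simp: orthogonal_list_def nth_Cons split: nat.splits)
    moreover have "?v \<bullet> d = 0" if "d \<in> carrier_vec m" "\<forall>w\<in>W. w \<bullet> d = 0" for d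
      using okQ that \<open>w \<in> W\<close> by (simp add: ok_def orthogonal_rest_scalar_prod[OF that(1) w Q(2)])
    ultimately have "ok (?v # Q)"
      using okQ by (auto simp: ok_def)
    from max[OF this] show False by simp
  qed
  \<comment> \<open>With zero residual, \<open>orthogonal_rest_scalar_prod\<close> expresses the
    product of w and d as a combination of the products of the members of Q with d.\<close>
  have W0: "\<forall>w\<in>W. w \<bullet> d = 0" if "d \<in> carrier_vec m" "\<forall>q\<in>set Q. q \<bullet> d = 0" for d
  proof
    fix w assume w: "w \<in> W"
    then have "w \<in> carrier_vec m" using assms by auto
    from orthogonal_rest_scalar_prod[OF that(1) this Q(2)] show "w \<bullet> d = 0"
      using that w by (simp add: rest0)
  qed
  have Q0: "\<forall>q\<in>set Q. q \<bullet> d = 0" if "d \<in> carrier_vec m" "\<forall>w\<in>W. w \<bullet> d = 0" for d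
    using okQ that by (simp add: ok_def)
  have "same_annihilator m (set Q) W"
    unfolding same_annihilator_def by (intro ballI iffI) (use W0 in blast, use Q0 in blast)
  with Q(1) show ?thesis by (rule that)
qed

lemma invertible_diagonal_mat:
  fixes D :: "real mat"
  assumes "D \<in> carrier_mat M M" "\<And>i j. i < M \<Longrightarrow> j < M \<Longrightarrow> D $$ (i, j) = 0 \<longleftrightarrow> i \<noteq> j"
  shows "diagonal_mat D \<and> invertible_mat D"
proof -
  define E where "E = mat M M (\<lambda>(i, j). if i = j then 1 / D $$ (i, i) else 0)"
  have nonzero: "D $$ (i, i) \<noteq> 0" if "i < M" for i using assms(2)[OF that that] by simp
  have zero: "D $$ (i, j) = 0" if "i < M" "j < M" "i \<noteq> j" for i j using assms(2)[OF that(1,2)] that by simp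
  have "(D * E) $$ (i, j) = D $$ (i, j) / D $$ (j, j)" if "i < M" "j < M" for i j
  proof -
    have "(D * E) $$ (i, j) = (\<Sum>k<M. D $$ (i, k) * E $$ (k, j))"
      using that assms(1) by (simp add: E_def scalar_prod_def atLeast0LessThan)
    also have "\<dots> = (\<Sum>k<M. if k = j then D $$ (i, j) / D $$ (j, j) else 0)"
      using that by (intro sum.cong) (auto simp: E_def)
    finally show ?thesis using that by simp
  qed
  then have DE: "D * E = 1\<^sub>m M"
    using assms(1) nonzero zero by (intro eq_matI) (auto simp: E_def)
  have "(E * D) $$ (i, j) = D $$ (i, j) / D $$ (i, i)" if "i < M" "j < M" for i j
  proof -
    have "(E * D) $$ (i, j) = (\<Sum>k<M. E $$ (i, k) * D $$ (k, j))"
      using that assms(1) by (simp add: E_def scalar_prod_def atLeast0LessThan)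
    also have "\<dots> = (\<Sum>k<M. if k = i then D $$ (i, j) / D $$ (i, i) else 0)"
      using that by (intro sum.cong) (auto simp: E_def)
    finally show ?thesis using that by simp
  qed
  then have ED: "E * D = 1\<^sub>m M"
    using assms(1) nonzero zero by (intro eq_matI) (auto simp: E_def)
  have "E \<in> carrier_mat M M" by (simp add: E_def)
  with DE ED have "invertible_mat D"
    using assms(1) unfolding invertible_mat_def inverts_mat_def by auto
  moreover have "diagonal_mat D"
    using assms(1) zero by (simp add: diagonal_mat_def)
  ultimately show ?thesis by simp
qed

text \<open>An equation for every p in D becomes finitely many rows. Since the entries of U and the
  function F are fixed linear forms in \<open>W p\<close>, the equation at p says that
  \<open>W p\<close> annihilates one vector that is affine in d, and an orthogonal list with the
  same annihilator as all the \<open>W p\<close> tests the same condition.\<close>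

lemma obtain_orthogonal_linear_system:
  fixes U W :: "'a \<Rightarrow> real vec"
  assumes U: "\<And>p. p \<in> D \<Longrightarrow> U p \<in> carrier_vec l"
    and W: "\<And>p. p \<in> D \<Longrightarrow> W p \<in> carrier_vec m"
    and spanU: "\<And>j. j < l \<Longrightarrow> \<exists>c\<in>carrier_vec m. \<forall>p\<in>D. U p $ j = W p \<bullet> c"
    and spanF: "\<exists>c\<in>carrier_vec m. \<forall>p\<in>D. F p = W p \<bullet> c"
  obtains A M b where "A \<in> carrier_mat M (l + m)" "b \<in> carrier_vec M"
    "diagonal_mat (col_block A l m * (col_block A l m)\<^sup>T)"
    "invertible_mat (col_block A l m * (col_block A l m)\<^sup>T)"
    "\<And>d. d \<in> carrier_vec (l + m) \<Longrightarrow> (\<forall>p\<in>D. (U p @\<^sub>v W p) \<bullet> d = F p) \<longleftrightarrow> A *\<^sub>v d = b"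
proof -
  obtain c where c: "c \<in> carrier_vec m" "\<And>p. p \<in> D \<Longrightarrow> F p = W p \<bullet> c"
    using spanF by blast
  obtain C where C: "\<And>j. j < l \<Longrightarrow> C j \<in> carrier_vec m"
      "\<And>j p. j < l \<Longrightarrow> p \<in> D \<Longrightarrow> U p $ j = W p \<bullet> C j"
    using spanU by metis
  obtain Q where Q: "orthogonal_list m Q" "same_annihilator m (set Q) (W ` D)"
    by (rule obtain_orthogonal_list_same_annihilator[of "W ` D" m]) (use W in auto)
  define M where "M = length Q"
  have Qc: "Q ! r \<in> carrier_vec m" if "r < M" for r
    using Q(1) that by (auto simp: orthogonal_list_def M_def)
  define A where "A = mat M (l + m) (\<lambda>(r, j). if j < l then Q ! r \<bullet> C j else Q ! r $ (j - l))"
  define b where "b = vec M (\<lambda>r. Q ! r \<bullet> c)"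
  \<comment> \<open>\<open>W p \<bullet> e d\<close> is the defect of the equation at p. The entries
    of A and b above are the coefficients of d and the constant of
    \<open>Q ! r \<bullet> e d\<close>, so row r of the system says that \<open>Q ! r\<close>
    annihilates \<open>e d\<close>.\<close>
  define e where "e d = vec m (\<lambda>k. (\<Sum>j<l. d $ j * C j $ k) + d $ (l + k) - c $ k)" for d :: "real vec"
  have e: "q \<bullet> e d = (\<Sum>j<l. (q \<bullet> C j) * d $ j) + (\<Sum>k<m. q $ k * d $ (l + k)) - q \<bullet> c"
    if "q \<in> carrier_vec m" for q d
  proof -
    have "(\<Sum>k<m. q $ k * (\<Sum>j<l. d $ j * C j $ k)) = (\<Sum>j<l. (\<Sum>k<m. q $ k * C j $ k) * d $ j)"
      unfolding sum_distrib_left sum_distrib_right by (subst sum.swap) (simp add: mult_ac)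
    then show ?thesis
      using that c(1) C(1)[THEN carrier_vecD]
      by (simp add: e_def scalar_prod_def atLeast0LessThan ring_distribs sum.distrib sum_subtractf)
  qed
  have split_sum: "(\<Sum>k<l + m. f k) = (\<Sum>k<l. f k) + (\<Sum>k<m. f (l + k))" for f :: "nat \<Rightarrow> real"
    by (induction m) (simp_all add: add.assoc)
  have lhs: "(U p @\<^sub>v W p) \<bullet> d = F p \<longleftrightarrow> W p \<bullet> e d = 0" if "p \<in> D" "d \<in> carrier_vec (l + m)" for p d
  proof -
    have "(U p @\<^sub>v W p) \<bullet> d = (\<Sum>j<l. (W p \<bullet> C j) * d $ j) + (\<Sum>k<m. W p $ k * d $ (l + k))"
      using U[OF that(1)] W[OF that(1)] that
      by (simp add: scalar_prod_def[of _ d] atLeast0LessThan split_sum C(2))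
    then show ?thesis using e[OF W[OF that(1)]] c(2)[OF that(1)] by auto
  qed
  have rhs: "(A *\<^sub>v d) $ r = b $ r \<longleftrightarrow> Q ! r \<bullet> e d = 0" if "r < M" "d \<in> carrier_vec (l + m)" for r d
    using that by (simp add: e[OF Qc] A_def b_def scalar_prod_def[of _ d] atLeast0LessThan split_sum)
  have A: "A \<in> carrier_mat M (l + m)" and b: "b \<in> carrier_vec M"
    by (simp_all add: A_def b_def)
  have equiv: "(\<forall>p\<in>D. (U p @\<^sub>v W p) \<bullet> d = F p) \<longleftrightarrow> A *\<^sub>v d = b" if d: "d \<in> carrier_vec (l + m)" for d
  proof -
    have "(\<forall>p\<in>D. (U p @\<^sub>v W p) \<bullet> d = F p) \<longleftrightarrow> (\<forall>w\<in>W ` D. w \<bullet> e d = 0)"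
      using lhs d by auto
    also have "\<dots> \<longleftrightarrow> (\<forall>q\<in>set Q. q \<bullet> e d = 0)"
      using Q(2) unfolding same_annihilator_def by (simp add: e_def)
    also have "\<dots> \<longleftrightarrow> (\<forall>r<M. (A *\<^sub>v d) $ r = b $ r)"
      using rhs d by (auto simp: M_def all_set_conv_all_nth)
    also have "\<dots> \<longleftrightarrow> A *\<^sub>v d = b"
      using A b by (auto simp: vec_eq_iff)
    finally show ?thesis .
  qed
  let ?A3 = "col_block A l m"
  have "?A3 * ?A3\<^sup>T \<in> carrier_mat M M"
    by (rule mult_carrier_mat[of _ M m]) (simp_all add: col_block_def A_def)
  moreover have "(?A3 * ?A3\<^sup>T) $$ (i, j) = 0 \<longleftrightarrow> i \<noteq> j" if "i < M" "j < M" for i j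
  proof -
    have "(?A3 * ?A3\<^sup>T) $$ (i, j) = Q ! i \<bullet> Q ! j"
      using that Qc[THEN carrier_vecD] by (simp add: col_block_def A_def scalar_prod_def)
    then show ?thesis using Q(1) that by (simp add: orthogonal_list_def M_def)
  qed
  ultimately have "diagonal_mat (?A3 * ?A3\<^sup>T) \<and> invertible_mat (?A3 * ?A3\<^sup>T)"
    by (rule invertible_diagonal_mat)
  then show ?thesis
    by (intro that[OF A b _ _ equiv]) simp_all
qed

section \<open>Polynomial functions with bounded bidegree\<close>

text \<open>Functions that agree on D with a finite linear combination of S. Equality is asked on D
  only, because the entries of a vector of the wrong length carry no information. Adding one
  generator at a time gives an induction that needs neither index sets nor coefficient
  families.\<close>

inductive fun_span :: "'a set \<Rightarrow> ('a \<Rightarrow> real) set \<Rightarrow> ('a \<Rightarrow> real) \<Rightarrow> bool"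
  for D S where
  zero: "(\<And>p. p \<in> D \<Longrightarrow> f p = 0) \<Longrightarrow> fun_span D S f"
| add: "g \<in> S \<Longrightarrow> fun_span D S f \<Longrightarrow> (\<And>p. p \<in> D \<Longrightarrow> h p = c * g p + f p) \<Longrightarrow> fun_span D S h"

lemma fun_span_cong:
  assumes "fun_span D S f" "\<And>p. p \<in> D \<Longrightarrow> g p = f p"
  shows "fun_span D S g"
  using assms by (induction arbitrary: g) (auto intro: fun_span.intros)

lemma fun_span_mono:
  assumes "fun_span D S f" "S \<subseteq> S'"
  shows "fun_span D S' f"
  using assms by induction (auto intro: fun_span.intros)

lemma fun_span_base: "g \<in> S \<Longrightarrow> fun_span D S g"
  by (rule fun_span.add[where c = 1 and f = "\<lambda>_. 0"]) (auto intro: fun_span.zero)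

lemma fun_span_plus:
  assumes "fun_span D S f" "fun_span D S g"
  shows "fun_span D S (\<lambda>p. f p + g p)"
  using assms
proof induction
  case (zero f)
  then show ?case by (auto intro: fun_span_cong)
next
  case (add u f h c)
  show ?case
    by (rule fun_span.add[OF add.hyps(1) add.IH[OF add.prems], of _ c])
      (simp add: add.hyps(3))
qed

lemma fun_span_scale:
  assumes "fun_span D S f"
  shows "fun_span D S (\<lambda>p. a * f p)"
  using assms
proof induction
  case (zero f)
  then show ?case by (auto intro: fun_span.zero)
next
  case (add u f h c)
  show ?case
    by (rule fun_span.add[OF add.hyps(1) add.IH, of _ "a * c"])
      (simp add: add.hyps(3) ring_distribs)
qed

text \<open>Expand f by its generators, and g for each of them; only products of two generators
  remain, and R contains these.\<close>

lemma fun_span_times: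
  assumes "fun_span D S f" "fun_span D T g" "\<And>u v. u \<in> S \<Longrightarrow> v \<in> T \<Longrightarrow> (\<lambda>p. u p * v p) \<in> R"
  shows "fun_span D R (\<lambda>p. f p * g p)"
  using assms(1)
proof induction
  case (zero f)
  then show ?case by (auto intro: fun_span.zero)
next
  case (add u f h c)
  have "fun_span D R (\<lambda>p. u p * g p)"
    using assms(2)
  proof induction
    case (zero g)
    then show ?case by (auto intro: fun_span.zero)
  next
    case (add v g h c)
    show ?case
      by (rule fun_span.add[OF assms(3)[OF \<open>u \<in> S\<close> add.hyps(1)] add.IH, of _ c])
        (simp add: add.hyps(3) ring_distribs)
  qed
  from fun_span_plus[OF fun_span_scale[OF this, of c] add.IH] show ?case
    by (rule fun_span_cong) (simp add: add.hyps(3) ring_distribs)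
qed

text \<open>Monomials are encoded by lists of variable indices with repetition instead of exponents:
  multiplying them is appending the lists, and factoring them is cutting the lists.\<close>

definition bimonomial :: "nat \<Rightarrow> nat list \<Rightarrow> nat list \<Rightarrow> real vec \<Rightarrow> real" where
  "bimonomial n xs ts p = prod_list (map (\<lambda>i. p $ i) xs) * prod_list (map (\<lambda>j. p $ (n + j)) ts)"

definition bimonomials :: "nat \<Rightarrow> nat \<Rightarrow> nat \<Rightarrow> nat \<Rightarrow> (real vec \<Rightarrow> real) set" where
  "bimonomials n N k b = {bimonomial n xs ts | xs ts. set xs \<subseteq> {..<n} \<and> set ts \<subseteq> {..<N} \<and>
     length xs + length ts \<le> k \<and> length ts \<le> b}"

text \<open>Polynomial functions on \<open>\<real>\<^bsup>n+N\<^esup>\<close> of total degree at most \<open>k\<close> and of degree at most \<open>b\<close> in the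
  last \<open>N\<close> variables.\<close>

definition bipoly :: "nat \<Rightarrow> nat \<Rightarrow> nat \<Rightarrow> nat \<Rightarrow> (real vec \<Rightarrow> real) \<Rightarrow> bool" where
  "bipoly n N k b f \<longleftrightarrow> fun_span (carrier_vec (n + N)) (bimonomials n N k b) f"

lemma bipoly_cong:
  "bipoly n N k b f \<Longrightarrow> (\<And>p. p \<in> carrier_vec (n + N) \<Longrightarrow> g p = f p) \<Longrightarrow> bipoly n N k b g"
  unfolding bipoly_def by (rule fun_span_cong)

lemma bipoly_mono: "bipoly n N k b f \<Longrightarrow> k \<le> k' \<Longrightarrow> b \<le> b' \<Longrightarrow> bipoly n N k' b' f"
  unfolding bipoly_def by (rule fun_span_mono) (force simp: bimonomials_def)+

lemma bipoly_add: "bipoly n N k b f \<Longrightarrow> bipoly n N k b g \<Longrightarrow> bipoly n N k b (\<lambda>p. f p + g p)"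
  unfolding bipoly_def by (rule fun_span_plus)

text \<open>The target bounds may exceed the sums of the degrees, so that summands of different
  degrees can be brought directly to one common bidegree.\<close>

lemma bipoly_mult:
  assumes "bipoly n N k b f" "bipoly n N k' b' g" "k + k' \<le> l" "b + b' \<le> c"
  shows "bipoly n N l c (\<lambda>p. f p * g p)"
proof -
  have "(\<lambda>p. u p * v p) \<in> bimonomials n N l c"
    if uv: "u \<in> bimonomials n N k b" "v \<in> bimonomials n N k' b'" for u v
  proof -
    obtain xs ts xs' ts' where
      "u = bimonomial n xs ts" "set xs \<subseteq> {..<n}" "set ts \<subseteq> {..<N}"
      "length xs + length ts \<le> k" "length ts \<le> b"
      "v = bimonomial n xs' ts'" "set xs' \<subseteq> {..<n}" "set ts' \<subseteq> {..<N}"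
      "length xs' + length ts' \<le> k'" "length ts' \<le> b'"
      using uv by (auto simp: bimonomials_def)
    moreover from this have "(\<lambda>p. u p * v p) = bimonomial n (xs @ xs') (ts @ ts')"
      by (simp add: bimonomial_def fun_eq_iff mult_ac)
    ultimately show ?thesis
      using assms(3,4) unfolding bimonomials_def
      by (intro CollectI exI[of _ "xs @ xs'"] exI[of _ "ts @ ts'"]) auto
  qed
  with assms(1,2) show ?thesis
    unfolding bipoly_def by (rule fun_span_times)
qed

lemma bipoly_const: "bipoly n N k b (\<lambda>_. a)"
proof -
  have "bipoly n N k b (bimonomial n [] [])"
    unfolding bipoly_def bimonomials_def
    by (intro fun_span_base CollectI exI[of _ "[]"]) simp
  then have "bipoly n N k b (\<lambda>p. a * bimonomial n [] [] p)"
    unfolding bipoly_def by (rule fun_span_scale)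
  then show ?thesis by (simp add: bimonomial_def)
qed

lemma bipoly_cmult: "bipoly n N k b f \<Longrightarrow> bipoly n N k b (\<lambda>p. a * f p)"
  unfolding bipoly_def by (rule fun_span_scale)

lemma bipoly_diff: "bipoly n N k b f \<Longrightarrow> bipoly n N k b g \<Longrightarrow> bipoly n N k b (\<lambda>p. f p - g p)"
  using bipoly_add[OF _ bipoly_cmult[of n N k b g "-1"]] by simp

lemma bipoly_divide: "bipoly n N k b f \<Longrightarrow> bipoly n N k b (\<lambda>p. f p / a)"
  using bipoly_cmult[of n N k b f "1 / a"] by simp

lemma bipoly_sum: "(\<And>i. i \<in> A \<Longrightarrow> bipoly n N k b (f i)) \<Longrightarrow> bipoly n N k b (\<lambda>p. \<Sum>i\<in>A. f i p)"
  by (induction A rule: infinite_finite_induct) (simp_all add: bipoly_const bipoly_add)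

lemma bipoly_x: "i < n \<Longrightarrow> 1 \<le> k \<Longrightarrow> bipoly n N k b (\<lambda>p. p $ i)"
  unfolding bipoly_def bimonomials_def
  by (intro fun_span_base CollectI exI[of _ "[i]"] exI[of _ "[]"]) (auto simp: bimonomial_def)

lemma bipoly_\<theta>: "j < N \<Longrightarrow> 1 \<le> k \<Longrightarrow> 1 \<le> b \<Longrightarrow> bipoly n N k b (\<lambda>p. p $ (n + j))"
  unfolding bipoly_def bimonomials_def
  by (intro fun_span_base CollectI exI[of _ "[]"] exI[of _ "[j]"]) (auto simp: bimonomial_def)

lemma bipoly_power: "bipoly n N k b f \<Longrightarrow> bipoly n N (k * e) (b * e) (\<lambda>p. f p ^ e)"
  by (induction e) (auto intro: bipoly_const bipoly_mult)

lemma bipoly_prod_power: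
  fixes m :: nat
  assumes "\<And>i. i < m \<Longrightarrow> bipoly n N k b (f i)"
  shows "bipoly n N (k * (\<Sum>i<m. e i)) (b * (\<Sum>i<m. e i)) (\<lambda>p. \<Prod>i<m. f i p ^ e i)"
  using assms
proof (induction m)
  case 0
  show ?case by (simp add: bipoly_const)
next
  case (Suc m)
  then have "bipoly n N (k * (\<Sum>i<m. e i)) (b * (\<Sum>i<m. e i)) (\<lambda>p. \<Prod>i<m. f i p ^ e i)"
    "bipoly n N (k * e m) (b * e m) (\<lambda>p. f m p ^ e m)"
    by (auto intro: bipoly_power)
  then show ?case
    by (simp del: mult_Suc) (erule (1) bipoly_mult; simp add: ring_distribs)
qed

definition bipoly_vec :: "nat \<Rightarrow> nat \<Rightarrow> nat \<Rightarrow> nat \<Rightarrow> nat \<Rightarrow> (real vec \<Rightarrow> real vec) \<Rightarrow> bool" where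
  "bipoly_vec n N l k b u \<longleftrightarrow>
     (\<forall>p\<in>carrier_vec (n + N). u p \<in> carrier_vec l) \<and> (\<forall>i<l. bipoly n N k b (\<lambda>p. u p $ i))"

lemma bipoly_vec_index: "bipoly_vec n N l k b u \<Longrightarrow> i < l \<Longrightarrow> bipoly n N k b (\<lambda>p. u p $ i)"
  by (simp add: bipoly_vec_def)

lemma bipoly_vecI:
  assumes "\<And>p. p \<in> carrier_vec (n + N) \<Longrightarrow> u p \<in> carrier_vec l"
    and "\<And>i. i < l \<Longrightarrow> bipoly n N k b (f i)"
    and "\<And>i p. i < l \<Longrightarrow> p \<in> carrier_vec (n + N) \<Longrightarrow> u p $ i = f i p"
  shows "bipoly_vec n N l k b u"
  using assms(1,3) unfolding bipoly_vec_def by (auto intro: bipoly_cong[OF assms(2)])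

lemma bipoly_vec_carrier: "bipoly_vec n N l k b u \<Longrightarrow> p \<in> carrier_vec (n + N) \<Longrightarrow> u p \<in> carrier_vec l"
  by (simp add: bipoly_vec_def)

lemma bipoly_vec_dim: "bipoly_vec n N l k b u \<Longrightarrow> p \<in> carrier_vec (n + N) \<Longrightarrow> dim_vec (u p) = l"
  unfolding bipoly_vec_def by auto

lemma bipoly_vec_mono: "bipoly_vec n N l k b u \<Longrightarrow> k \<le> k' \<Longrightarrow> b \<le> b' \<Longrightarrow> bipoly_vec n N l k' b' u"
  by (auto simp: bipoly_vec_def intro: bipoly_mono)

lemma bipoly_vec_const: "v \<in> carrier_vec l \<Longrightarrow> bipoly_vec n N l k b (\<lambda>_. v)"
  by (simp add: bipoly_vec_def bipoly_const)

lemma bipoly_scalar_prod: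
  assumes "bipoly_vec n N l k b u" "bipoly_vec n N l k' b' v" "k + k' \<le> k''" "b + b' \<le> b''"
  shows "bipoly n N k'' b'' (\<lambda>p. u p \<bullet> v p)"
proof (rule bipoly_cong[where f = "\<lambda>p. \<Sum>i<l. u p $ i * v p $ i"])
  show "bipoly n N k'' b'' (\<lambda>p. \<Sum>i<l. u p $ i * v p $ i)"
    using assms by (intro bipoly_sum bipoly_mult[OF _ _ assms(3,4)]) (auto simp: bipoly_vec_def)
qed (use assms in \<open>auto simp: bipoly_vec_def scalar_prod_def atLeast0LessThan\<close>)

lemma bipoly_vec_append:
  assumes "bipoly_vec n N l k b u" "bipoly_vec n N l' k b v"
  shows "bipoly_vec n N (l + l') k b (\<lambda>p. u p @\<^sub>v v p)"
proof (rule bipoly_vecI[where f = "\<lambda>i p. if i < l then u p $ i else v p $ (i - l)"])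
  show "bipoly n N k b (\<lambda>p. if i < l then u p $ i else v p $ (i - l))" if "i < l + l'" for i
    using assms that by (cases "i < l") (auto intro: bipoly_vec_index)
qed (use assms in \<open>auto simp: bipoly_vec_dim bipoly_vec_carrier\<close>)

lemma bipoly_vec_smult:
  assumes "bipoly n N k b f" "bipoly_vec n N l k' b' v" "k + k' \<le> k''" "b + b' \<le> b''"
  shows "bipoly_vec n N l k'' b'' (\<lambda>p. f p \<cdot>\<^sub>v v p)"
proof (rule bipoly_vecI[where f = "\<lambda>i p. f p * v p $ i"])
  show "bipoly n N k'' b'' (\<lambda>p. f p * v p $ i)" if "i < l" for i
    by (rule bipoly_mult[OF assms(1) bipoly_vec_index[OF assms(2) that] assms(3,4)])
qed (use assms in \<open>auto simp: bipoly_vec_dim bipoly_vec_carrier\<close>)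

section \<open>Concatenated vectors and their scalar products\<close>

lemma append_vec_assoc: "(u @\<^sub>v v) @\<^sub>v w = u @\<^sub>v v @\<^sub>v w"
  by (rule eq_vecI) auto

lemma concat_vecs_Cons: "concat_vecs (v # vs) = v @\<^sub>v concat_vecs vs"
  by (simp add: concat_vecs_def)

lemma concat_vecs_carrier:
  "set vs \<subseteq> carrier_vec l \<Longrightarrow> concat_vecs vs \<in> carrier_vec (length vs * l)"
  by (induction vs) (simp_all add: concat_vecs_def)

lemma concat_vecs_append:
  "concat_vecs (us @ vs) = concat_vecs us @\<^sub>v concat_vecs vs"
  by (induction us) (simp_all add: concat_vecs_def append_vec_assoc)

lemma concat_vecs_single: "concat_vecs [v] = v"
  by (rule eq_vecI) (auto simp: concat_vecs_def)

lemma bipoly_vec_concat_map: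
  assumes "\<And>h. h \<in> set hs \<Longrightarrow> bipoly_vec n N l k b (f h)"
  shows "bipoly_vec n N (length hs * l) k b (\<lambda>p. concat_vecs (map (\<lambda>h. f h p) hs))"
  using assms
proof (induction hs)
  case Nil
  show ?case by (simp add: bipoly_vec_def concat_vecs_def)
next
  case (Cons h hs)
  then show ?case by (simp add: concat_vecs_Cons bipoly_vec_append)
qed

lemma concat_vecs_scalar_prod:
  assumes "length us = length vs" "set us \<subseteq> carrier_vec l" "set vs \<subseteq> carrier_vec l"
  shows "concat_vecs us \<bullet> concat_vecs vs = (\<Sum>j<length vs. us ! j \<bullet> vs ! j)"
  using assms
proof (induction us vs rule: list_induct2)
  case Nil
  show ?case by (simp add: concat_vecs_def)
next
  case (Cons u us v vs)
  then have "concat_vecs (u # us) \<bullet> concat_vecs (v # vs) = u \<bullet> v + concat_vecs us \<bullet> concat_vecs vs"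
    unfolding concat_vecs_Cons
    using concat_vecs_carrier[of us l] concat_vecs_carrier[of vs l]
    by (subst scalar_prod_append[of _ l _ "length us * l"]) auto
  with Cons show ?case by (simp add: sum.lessThan_Suc_shift del: sum.lessThan_Suc)
qed

lemma set_exponents: "set (exponents n d) = {\<alpha>. length \<alpha> = n \<and> sum_list \<alpha> = d}"
proof (induction n arbitrary: d)
  case 0
  then show ?case by auto
next
  case (Suc n)
  have *: "\<alpha> \<in> set (exponents (Suc n) d)
      \<longleftrightarrow> (\<exists>k as. \<alpha> = k # as \<and> k \<le> d \<and> length as = n \<and> sum_list as = d - k)" for \<alpha>
    by (auto simp: Suc.IH less_Suc_eq_le simp del: upt_Suc)
  have **: "(\<exists>k as. \<alpha> = k # as \<and> k \<le> d \<and> length as = n \<and> sum_list as = d - k)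
      \<longleftrightarrow> length \<alpha> = Suc n \<and> sum_list \<alpha> = d" for \<alpha>
    by (cases \<alpha>) auto
  show ?case by (simp only: set_eq_iff mem_Collect_eq * **) simp
qed

section \<open>Bidegrees of the vectors occurring in the problems\<close>

lemma bipoly_vec_self: "1 \<le> k \<Longrightarrow> 1 \<le> b \<Longrightarrow> bipoly_vec n N (n + N) k b (\<lambda>p. p)"
  unfolding bipoly_vec_def
proof (intro conjI ballI allI impI)
  fix i assume k: "1 \<le> k" "1 \<le> b" and i: "i < n + N"
  show "bipoly n N k b (\<lambda>p. p $ i)"
    using k i bipoly_x[of i n k N b] bipoly_\<theta>[of "i - n" N k b n] by (cases "i < n") auto
qed

lemma bipoly_vec_x: "1 \<le> k \<Longrightarrow> bipoly_vec n N n k b (\<lambda>p. vec_first p n)"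
  by (rule bipoly_vecI[where f = "\<lambda>i p. p $ i"]) (auto simp: vec_first_def intro: bipoly_x)

lemma bipoly_vec_\<theta>: "1 \<le> k \<Longrightarrow> 1 \<le> b \<Longrightarrow> bipoly_vec n N N k b (\<lambda>p. vec_last p N)"
  by (rule bipoly_vecI[where f = "\<lambda>i p. p $ (n + i)"]) (auto simp: vec_last_def intro: bipoly_\<theta>)

lemma bipoly_vec_first:
  "bipoly_vec n N l k b u \<Longrightarrow> m \<le> l \<Longrightarrow> bipoly_vec n N m k b (\<lambda>p. vec_first (u p) m)"
  by (rule bipoly_vecI[where f = "\<lambda>i p. u p $ i"])
    (auto simp: vec_first_def intro: bipoly_vec_index)

lemma bipoly_vec_last:
  "bipoly_vec n N l k b u \<Longrightarrow> m \<le> l \<Longrightarrow> bipoly_vec n N m k b (\<lambda>p. vec_last (u p) m)"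
  by (rule bipoly_vecI[where f = "\<lambda>i p. u p $ (l - m + i)"])
    (auto simp: vec_last_def bipoly_vec_dim intro: bipoly_vec_index)

lemma bipoly_vec_minus:
  assumes "bipoly_vec n N l k b u" "bipoly_vec n N l k b v"
  shows "bipoly_vec n N l k b (\<lambda>p. u p - v p)"
  by (rule bipoly_vecI[where f = "\<lambda>i p. u p $ i - v p $ i"])
    (use assms in \<open>auto simp: bipoly_vec_dim bipoly_vec_def intro: bipoly_diff\<close>)

lemma cross_index:
  "cross a b $ 0 = a $ 1 * b $ 2 - a $ 2 * b $ 1"
  "cross a b $ 1 = a $ 2 * b $ 0 - a $ 0 * b $ 2"
  "cross a b $ 2 = a $ 0 * b $ 1 - a $ 1 * b $ 0"
  by (simp_all add: cross_def numeral_2_eq_2)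

lemma cross_carrier: "cross a b \<in> carrier_vec 3"
  by (rule carrier_vecI) (simp add: cross_def)

lemma bipoly_vec_cross:
  assumes "bipoly_vec n N 3 k b u" "bipoly_vec n N 3 k' b' v" "k + k' \<le> k''" "b + b' \<le> b''"
  shows "bipoly_vec n N 3 k'' b'' (\<lambda>p. cross (u p) (v p))"
proof (rule bipoly_vecI[where f = "\<lambda>i p. cross (u p) (v p) $ i"])
  have m: "bipoly n N k'' b'' (\<lambda>p. u p $ i * v p $ j)" if "i < 3" "j < 3" for i j
    using that assms by (intro bipoly_mult[OF _ _ assms(3,4)]) (auto intro: bipoly_vec_index)
  fix i :: nat assume "i < 3"
  then consider "i = 0" | "i = 1" | "i = 2" by linarith
  then show "bipoly n N k'' b'' (\<lambda>p. cross (u p) (v p) $ i)"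
  proof cases
    case 1
    show ?thesis unfolding 1 cross_index by (rule bipoly_diff; rule m) simp_all
  next
    case 2
    show ?thesis unfolding 2 cross_index by (rule bipoly_diff; rule m) simp_all
  next
    case 3
    show ?thesis unfolding 3 cross_index by (rule bipoly_diff; rule m) simp_all
  qed
qed (simp_all add: cross_carrier)

lemma bipoly_vec_unvec3_mult:
  assumes "bipoly_vec n N 9 k b u" "v \<in> carrier_vec 3"
  shows "bipoly_vec n N 3 k b (\<lambda>p. unvec3 (u p) *\<^sub>v v)"
proof (rule bipoly_vecI[where f = "\<lambda>i p. \<Sum>j<3. v $ j * u p $ (3 * j + i)"])
  show "bipoly n N k b (\<lambda>p. \<Sum>j<3. v $ j * u p $ (3 * j + i))" if "i < 3" for i
    using that by (intro bipoly_sum bipoly_cmult bipoly_vec_index[OF assms(1)]) auto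
  show "unvec3 (u p) *\<^sub>v v \<in> carrier_vec 3" for p
    by (rule carrier_vecI) (simp add: unvec3_def)
  show "(unvec3 (u p) *\<^sub>v v) $ i = (\<Sum>j<3. v $ j * u p $ (3 * j + i))" if "i < 3" for i p
    using that carrier_vecD[OF assms(2)]
    by (simp add: unvec3_def scalar_prod_def atLeast0LessThan mult.commute)
qed

lemma bipoly_vec_col_unvec3:
  "bipoly_vec n N 9 k b u \<Longrightarrow> j < 3 \<Longrightarrow> bipoly_vec n N 3 k b (\<lambda>p. col (unvec3 (u p)) j)"
  by (rule bipoly_vecI[where f = "\<lambda>i p. u p $ (3 * j + i)"])
    (auto simp: unvec3_def intro: bipoly_vec_index)

lemma bipoly_vec_two_rows_mult:
  assumes "bipoly_vec n N m k b u" "bipoly_vec n N m k b u'" "v \<in> carrier_vec m"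
  shows "bipoly_vec n N 2 k b (\<lambda>p. mat_of_rows m [u p, u' p] *\<^sub>v v)"
proof (rule bipoly_vecI[where f = "\<lambda>i p. (if i = 0 then u p else u' p) \<bullet> v"])
  show "bipoly n N k b (\<lambda>p. (if i = 0 then u p else u' p) \<bullet> v)" for i
    using bipoly_scalar_prod[OF assms(1) bipoly_vec_const[OF assms(3), of n N 0 0]]
      bipoly_scalar_prod[OF assms(2) bipoly_vec_const[OF assms(3), of n N 0 0]]
    by (cases "i = 0") simp_all
next
  fix i :: nat and p :: "real vec" assume "i < 2" "p \<in> carrier_vec (n + N)"
  with assms show "(mat_of_rows m [u p, u' p] *\<^sub>v v) $ i = (if i = 0 then u p else u' p) \<bullet> v"
    by (auto simp: bipoly_vec_def less_2_cases_iff)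
qed (rule carrier_vecI, simp)

text \<open>The parameter b separates the two uses: b = 1 for monomials in p, whose \<theta>-degree
  may reach d, and b = 0 for monomials in x, whose \<theta>-degree stays 0.\<close>

lemma bipoly_monomials_le:
  assumes "bipoly_vec n N l 1 b u"
  shows "bipoly_vec n N (m_dim l d) d (b * d) (\<lambda>p. monomials_le (u p) d)"
proof -
  define L where "L = concat (map (exponents l) [0..<Suc d])"
  \<comment> \<open>The exponent list depends only on the number of variables, so its length can be
    read off at the zero vector.\<close>
  have L: "length L = m_dim l d"
    using dim_monomials_le[of "0\<^sub>v l" d] by (simp add: monomials_le_def L_def del: upt_Suc)
  have eq: "monomials_le (u p) d = vec_of_list (map (monomial (u p)) L)"
    if "p \<in> carrier_vec (n + N)" for p
    by (simp only: monomials_le_def L_def bipoly_vec_dim[OF assms that])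
  show ?thesis
  proof (rule bipoly_vecI[where f = "\<lambda>i p. \<Prod>j<l. u p $ j ^ (L ! i ! j)"])
    fix i assume i: "i < m_dim l d"
    then have "L ! i \<in> set L" by (simp add: L)
    then have \<alpha>: "length (L ! i) = l" "sum_list (L ! i) \<le> d"
      by (auto simp: L_def set_exponents simp del: upt_Suc)
    then have d: "(\<Sum>j<l. L ! i ! j) \<le> d"
      by (simp add: sum_list_sum_nth atLeast0LessThan)
    have "bipoly n N (1 * (\<Sum>j<l. L ! i ! j)) (b * (\<Sum>j<l. L ! i ! j))
        (\<lambda>p. \<Prod>j<l. u p $ j ^ (L ! i ! j))"
      by (rule bipoly_prod_power) (rule bipoly_vec_index[OF assms])
    then show "bipoly n N d (b * d) (\<lambda>p. \<Prod>j<l. u p $ j ^ (L ! i ! j))"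
      by (rule bipoly_mono) (use d in simp_all)
    show "monomials_le (u p) d $ i = (\<Prod>j<l. u p $ j ^ (L ! i ! j))"
      if "p \<in> carrier_vec (n + N)" for p
      using i \<alpha> by (simp add: eq[OF that] vec_of_list_index L monomial_def)
  qed (rule carrier_vecI, simp add: dim_monomials_le bipoly_vec_dim[OF assms])
qed

section \<open>Quadratic forms as linear forms in the symmetric vectorization\<close>

definition outer_prod :: "real vec \<Rightarrow> real mat" where
  "outer_prod q = mat (dim_vec q) (dim_vec q) (\<lambda>(i, j). q $ i * q $ j)"

lemma outer_prod_sym: "q \<in> carrier_vec m \<Longrightarrow> outer_prod q \<in> sym_mats m"
  by (auto simp: outer_prod_def sym_mats_def)

text \<open>The quadratic form is the trace of the product of the outer product of q with S, and
  \<open>svec\<close> is an isometry for the trace inner product.\<close>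

lemma quadratic_form_eq_svec:
  assumes "S \<in> sym_mats m" "q \<in> carrier_vec m"
  shows "q \<bullet> (S *\<^sub>v q) = svec (outer_prod q) \<bullet> svec S"
proof -
  have S: "S \<in> carrier_mat m m" "S\<^sup>T = S" using assms by (auto simp: sym_mats_def)
  have sym: "S $$ (i, j) = S $$ (j, i)" if "i < m" "j < m" for i j
    using S that by (metis carrier_matD index_transpose_mat(1))
  have "svec (outer_prod q) \<bullet> svec S = (\<Sum>i<m. (outer_prod q * S) $$ (i, i))"
    by (rule svec_scalar_prod[OF outer_prod_sym assms(1), symmetric]) (rule assms(2))
  also have "\<dots> = (\<Sum>i<m. q $ i * (\<Sum>j<m. S $$ (i, j) * q $ j))"
    using S(1) assms(2)
    by (intro sum.cong)
      (auto simp: outer_prod_def scalar_prod_def atLeast0LessThan sum_distrib_left sym mult_ac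
        intro!: sum.cong)
  also have "\<dots> = q \<bullet> (S *\<^sub>v q)"
    using S(1) assms(2) by (simp add: scalar_prod_def atLeast0LessThan)
  finally show ?thesis by simp
qed

lemma product_eq_svec:
  assumes "i < m" "j < m"
  shows "\<exists>c\<in>carrier_vec (svec_dim m). \<forall>q\<in>carrier_vec m. q $ i * q $ j = svec (outer_prod q) \<bullet> c"
proof -
  \<comment> \<open>The symmetric matrix of the quadratic form that multiplies entries i and j.
    Adding two halves also covers i = j, where they meet on the diagonal and give 1.\<close>
  let ?E = "mat m m (\<lambda>(a, b). (if a = i then if b = j then 1 / 2 else 0 else 0)
    + (if a = j then if b = i then 1 / 2 else 0 else 0 :: real))"
  have sym: "?E \<in> sym_mats m" by (auto simp: sym_mats_def)
  have "q $ i * q $ j = q \<bullet> (?E *\<^sub>v q)" if "q \<in> carrier_vec m" for q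
    using that assms
    by (simp add: scalar_prod_def atLeast0LessThan distrib_right distrib_left sum.distrib
        if_distrib[where f = "\<lambda>x. x * _"] if_distrib[where f = "\<lambda>x. _ * x"]
        if_distrib[where f = "sum _"] sum.If_cases cong: if_cong)
  then have "\<forall>q\<in>carrier_vec m. q $ i * q $ j = svec (outer_prod q) \<bullet> svec ?E"
    by (simp add: quadratic_form_eq_svec[OF sym])
  moreover have "svec ?E \<in> carrier_vec (svec_dim m)"
    by (rule carrier_vecI) (simp add: dim_svec)
  ultimately show ?thesis by blast
qed

text \<open>The matrix position behind each entry of \<open>svec\<close>: the upper triangle, column
  by column. It allows entrywise arguments about \<open>svec\<close>.\<close>

definition svec_positions :: "nat \<Rightarrow> (nat \<times> nat) list" where
  "svec_positions m = concat (map (\<lambda>j. map (\<lambda>i. (i, j)) [0..<Suc j]) [0..<m])"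

lemma svec_eq_map:
  assumes "S \<in> carrier_mat m m"
  shows "svec S =
    vec_of_list (map (\<lambda>(i, j). (if i = j then 1 else sqrt 2) * S $$ (i, j)) (svec_positions m))"
  using assms by (auto simp: svec_def svec_positions_def map_concat comp_def simp del: upt_Suc
      intro!: arg_cong[where f = vec_of_list] arg_cong[where f = concat])

lemma length_svec_positions: "length (svec_positions m) = svec_dim m"
  using dim_svec[of "0\<^sub>m m m"] by (simp add: svec_eq_map[of _ m])

lemma svec_index:
  assumes "S \<in> carrier_mat m m" "r < svec_dim m" "svec_positions m ! r = (i, j)"
  shows "svec S $ r = (if i = j then 1 else sqrt 2) * S $$ (i, j)"
  using assms by (simp add: svec_eq_map vec_of_list_index length_svec_positions)

lemma set_svec_positions: "set (svec_positions m) = {(i, j). i \<le> j \<and> j < m}"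
  by (auto simp: svec_positions_def simp del: upt_Suc)

lemma svec_positions_less:
  assumes "r < svec_dim m" "svec_positions m ! r = (i, j)"
  shows "i < m" "j < m"
  using assms nth_mem[of r "svec_positions m"]
  by (auto simp: set_svec_positions length_svec_positions)

lemma bipoly_vec_svec_outer_prod:
  assumes "bipoly_vec n N m k b q"
  shows "bipoly_vec n N (svec_dim m) (k + k) (b + b) (\<lambda>p. svec (outer_prod (q p)))"
proof -
  have c: "outer_prod (q p) \<in> carrier_mat m m" if "p \<in> carrier_vec (n + N)" for p
    using bipoly_vec_dim[OF assms that] by (simp add: outer_prod_def)
  show ?thesis
  proof (rule bipoly_vecI[where f = "\<lambda>r p. case svec_positions m ! r of (i, j) \<Rightarrow>
        (if i = j then 1 else sqrt 2) * (q p $ i * q p $ j)"])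
    fix r assume r: "r < svec_dim m"
    obtain i j where ij: "svec_positions m ! r = (i, j)" by fastforce
    note lt = svec_positions_less[OF r ij]
    show "bipoly n N (k + k) (b + b)
        (\<lambda>p. case svec_positions m ! r of (i, j) \<Rightarrow> (if i = j then 1 else sqrt 2) * (q p $ i * q p $ j))"
      unfolding ij prod.case using assms lt
      by (intro bipoly_cmult bipoly_mult[OF _ _ order_refl order_refl]) (auto intro: bipoly_vec_index)
    show "svec (outer_prod (q p)) $ r = (case svec_positions m ! r of (i, j) \<Rightarrow>
        (if i = j then 1 else sqrt 2) * (q p $ i * q p $ j))"
      if "p \<in> carrier_vec (n + N)" for p
      unfolding svec_index[OF c[OF that] r ij] ij prod.case
      using lt bipoly_vec_dim[OF assms that] by (simp add: outer_prod_def)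
  next
    show "svec (outer_prod (q p)) \<in> carrier_vec (svec_dim m)" if "p \<in> carrier_vec (n + N)" for p
      using c[OF that] by (intro carrier_vecI) (simp add: dim_svec)
  qed
qed

section \<open>Monomials as products of two basis entries\<close>

definition is_coordinate :: "real vec set \<Rightarrow> (real vec \<Rightarrow> real vec) \<Rightarrow> (real vec \<Rightarrow> real) \<Rightarrow> bool" where
  "is_coordinate D u f \<longleftrightarrow> (\<exists>i. \<forall>p\<in>D. i < dim_vec (u p) \<and> f p = u p $ i)"

lemma is_coordinate_appendL: "is_coordinate D u f \<Longrightarrow> is_coordinate D (\<lambda>p. u p @\<^sub>v v p) f"
  unfolding is_coordinate_def by (metis index_append_vec trans_less_add1)

lemma is_coordinate_appendR:
  assumes "is_coordinate D v f" "\<And>p. p \<in> D \<Longrightarrow> dim_vec (u p) = l"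
  shows "is_coordinate D (\<lambda>p. u p @\<^sub>v v p) f"
proof -
  obtain i where "\<forall>p\<in>D. i < dim_vec (v p) \<and> f p = v p $ i"
    using assms(1) by (auto simp: is_coordinate_def)
  with assms(2) show ?thesis
    unfolding is_coordinate_def by (intro exI[of _ "l + i"]) auto
qed

text \<open>Monomials with at most two factors and at most one \<theta> are exactly those listed in
  \<open>basis_B\<close>. The position found is the same for all p, which later makes the
  coefficient vector independent of p.\<close>

lemma bimonomial_is_coordinate:
  assumes "ts = [] \<and> length xs \<le> 2 \<or> length ts = 1 \<and> length xs \<le> 1"
    and "set xs \<subseteq> {..<n}" "set ts \<subseteq> {..<N}"
  shows "is_coordinate (carrier_vec (n + N)) (\<lambda>p. basis_B (vec_first p n) (vec_last p N))
    (bimonomial n xs ts)" (is "is_coordinate ?D _ _")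
proof -
  have last: "vec_last p N $ j = p $ (n + j)" if "p \<in> ?D" "j < N" for p j
    using that by (simp add: vec_last_def)
  \<comment> \<open>The five cases are the five blocks of \<open>basis_B\<close>, in their order of
    appearance.\<close>
  consider "xs = []" "ts = []" | i where "xs = [i]" "ts = []" "i < n"
    | j where "xs = []" "ts = [j]" "j < N"
    | i i' where "xs = [i, i']" "ts = []" "i < n" "i' < n"
    | i j where "xs = [i]" "ts = [j]" "i < n" "j < N"
    using assms
    by (cases xs rule: remdups_adj.cases; cases ts rule: remdups_adj.cases) auto
  then show ?thesis
  proof cases
    case 1
    have "is_coordinate ?D (\<lambda>p. vec_of_list [1]) (bimonomial n xs ts)"
      using 1 unfolding is_coordinate_def by (intro exI[of _ 0]) (auto simp: bimonomial_def)
    then show ?thesis unfolding basis_B_def by (rule is_coordinate_appendL)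
  next
    case (2 i)
    have "is_coordinate ?D (\<lambda>p. vec_first p n) (bimonomial n xs ts)"
      using 2 unfolding is_coordinate_def
      by (intro exI[of _ i]) (auto simp: bimonomial_def vec_first_def)
    then show ?thesis unfolding basis_B_def
      by (intro is_coordinate_appendR[where l = 1] is_coordinate_appendL) auto
  next
    case (3 j)
    have "is_coordinate ?D (\<lambda>p. vec_last p N) (bimonomial n xs ts)"
      using 3 unfolding is_coordinate_def
      by (intro exI[of _ j]) (auto simp: bimonomial_def last)
    then show ?thesis unfolding basis_B_def
      by (intro is_coordinate_appendR[where l = 1] is_coordinate_appendR[where l = n]
          is_coordinate_appendL) auto
  next
    case (4 i i')
    \<comment> \<open>The exponent list counts occurrences, so that i = i' gives the single exponent
      2 and needs no separate case.\<close>
    define \<alpha> where "\<alpha> = map (\<lambda>k. (if k = i then 1 else 0) + (if k = i' then 1 else 0 :: nat)) [0..<n]"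
    have "sum_list \<alpha> = 2"
      using 4 by (simp add: \<alpha>_def sum_list_sum_nth sum.distrib)
    then have "\<alpha> \<in> set (exponents n 2)"
      by (simp add: set_exponents \<alpha>_def)
    then obtain r where r: "r < length (exponents n 2)" "exponents n 2 ! r = \<alpha>"
      by (auto simp: in_set_conv_nth)
    have "monomial x \<alpha> = x $ i * x $ i'" for x
    proof -
      have "monomial x \<alpha> = (\<Prod>k<n. (if k = i then x $ k else 1) * (if k = i' then x $ k else 1))"
        unfolding monomial_def by (intro prod.cong) (auto simp: \<alpha>_def)
      also have "\<dots> = x $ i * x $ i'"
        using 4 by (simp add: prod.distrib)
      finally show ?thesis .
    qed
    then have "is_coordinate ?D (\<lambda>p. monomials_eq (vec_first p n) 2) (bimonomial n xs ts)"
      using 4 r unfolding is_coordinate_def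
      by (intro exI[of _ r])
        (auto simp: bimonomial_def vec_first_def monomials_eq_def vec_of_list_index)
    then show ?thesis unfolding basis_B_def
      by (intro is_coordinate_appendR[where l = 1] is_coordinate_appendR[where l = n]
          is_coordinate_appendR[where l = N] is_coordinate_appendL) auto
  next
    case (5 i j)
    \<comment> \<open>In the Kronecker product \<theta> is the outer factor, so the entry for
      \<theta> index j and x index i stands at \<open>j * n + i\<close>.\<close>
    have "j * n + i < Suc j * n" using 5 by simp
    also have "\<dots> \<le> N * n" using 5 by (intro mult_le_mono1) simp
    finally have "j * n + i < N * n" .
    then have "is_coordinate ?D (\<lambda>p. kron_vec (vec_last p N) (vec_first p n)) (bimonomial n xs ts)"
      using 5 unfolding is_coordinate_def
      by (intro exI[of _ "j * n + i"]) (auto simp: bimonomial_def vec_first_def kron_vec_def last)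
    then show ?thesis unfolding basis_B_def
      by (intro is_coordinate_appendR[where l = 1] is_coordinate_appendR[where l = n]
          is_coordinate_appendR[where l = N]
          is_coordinate_appendR[where l = "length (exponents n 2)"])
        (auto simp: monomials_eq_def)
  qed
qed

lemma bimonomial_append:
  "bimonomial n (xs @ xs') (ts @ ts') p = bimonomial n xs ts p * bimonomial n xs' ts' p"
  by (simp add: bimonomial_def)

text \<open>Without \<theta>-factors, cut the at most four x-factors after the second. Otherwise
  give the first part one \<theta> and at most one x: the remainder has either no \<theta> and at
  most two x, or one \<theta> and at most one x.\<close>

lemma bimonomial_4_2_split:
  assumes "length xs + length ts \<le> 4" "length ts \<le> 2"
  obtains xs1 xs2 ts1 ts2 where "xs = xs1 @ xs2" "ts = ts1 @ ts2"
    "ts1 = [] \<and> length xs1 \<le> 2 \<or> length ts1 = 1 \<and> length xs1 \<le> 1"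
    "ts2 = [] \<and> length xs2 \<le> 2 \<or> length ts2 = 1 \<and> length xs2 \<le> 1"
proof (cases "ts = []")
  case True
  with assms that[of "take 2 xs" "drop 2 xs" "[]" "[]"] show ?thesis by auto
next
  case False
  then have "length ts = 1 \<or> length ts = 2"
    using assms(2) by (cases ts) (auto simp: le_Suc_eq)
  then show ?thesis
    using assms that[of "take 1 xs" "drop 1 xs" "take 1 ts" "drop 1 ts"] by auto
qed

text \<open>Each generating monomial is a product of two basis entries, hence a fixed linear form in
  the vectorized outer product; linear combinations of such forms are again of this kind.\<close>

lemma bipoly_4_2_eq_svec:
  assumes "bipoly n N 4 2 f"
  shows "\<exists>c\<in>carrier_vec (svec_dim (mB_dim n N)). \<forall>p\<in>carrier_vec (n + N).
    f p = svec (outer_prod (basis_B (vec_first p n) (vec_last p N))) \<bullet> c"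
proof -
  let ?D = "carrier_vec (n + N)" and ?m = "mB_dim n N"
  let ?q = "\<lambda>p. basis_B (vec_first p n) (vec_last p N)"
  let ?W = "\<lambda>p. svec (outer_prod (?q p))"
  have q: "?q p \<in> carrier_vec ?m" for p :: "real vec"
    by (rule carrier_vecI) (simp add: dim_basis_B)
  have W: "?W p \<in> carrier_vec (svec_dim ?m)" for p :: "real vec"
    by (rule carrier_vecI) (simp add: dim_svec outer_prod_def dim_basis_B)
  have base: "\<exists>c\<in>carrier_vec (svec_dim ?m). \<forall>p\<in>?D. g p = ?W p \<bullet> c" if "g \<in> bimonomials n N 4 2" for g
  proof -
    obtain xs ts where g: "g = bimonomial n xs ts" "set xs \<subseteq> {..<n}" "set ts \<subseteq> {..<N}"
      "length xs + length ts \<le> 4" "length ts \<le> 2"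
      using \<open>g \<in> _\<close> unfolding bimonomials_def by blast
    obtain xs1 xs2 ts1 ts2 where s: "xs = xs1 @ xs2" "ts = ts1 @ ts2"
      "ts1 = [] \<and> length xs1 \<le> 2 \<or> length ts1 = 1 \<and> length xs1 \<le> 1"
      "ts2 = [] \<and> length xs2 \<le> 2 \<or> length ts2 = 1 \<and> length xs2 \<le> 1"
      using bimonomial_4_2_split[OF g(4,5)] .
    have "is_coordinate ?D ?q (bimonomial n xs1 ts1)" "is_coordinate ?D ?q (bimonomial n xs2 ts2)"
      using g(2,3) s by (auto intro!: bimonomial_is_coordinate)
    then obtain i j where ij: "\<forall>p\<in>?D. i < ?m \<and> bimonomial n xs1 ts1 p = ?q p $ i"
      "\<forall>p\<in>?D. j < ?m \<and> bimonomial n xs2 ts2 p = ?q p $ j"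
      by (auto simp: is_coordinate_def dim_basis_B)
    \<comment> \<open>The bounds are stated under a quantifier over p; the zero vector serves as the
      point at which to read them off.\<close>
    then have "i < ?m" "j < ?m" using zero_carrier_vec by blast+
    from product_eq_svec[OF this] obtain c where c: "c \<in> carrier_vec (svec_dim ?m)"
      "\<forall>q\<in>carrier_vec ?m. q $ i * q $ j = svec (outer_prod q) \<bullet> c" by blast
    then have "\<forall>p\<in>?D. g p = ?W p \<bullet> c"
      using ij q by (simp add: g(1) s(1,2) bimonomial_append)
    with c(1) show ?thesis by blast
  qed
  from assms show ?thesis unfolding bipoly_def
  proof induction
    case (zero f)
    then show ?case using W by (intro bexI[of _ "0\<^sub>v (svec_dim ?m)"]) auto
  next
    case (add g f h a)
    obtain c c' where "c \<in> carrier_vec (svec_dim ?m)" "c' \<in> carrier_vec (svec_dim ?m)"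
      "\<forall>p\<in>?D. g p = ?W p \<bullet> c" "\<forall>p\<in>?D. f p = ?W p \<bullet> c'"
      using add.IH base[OF add.hyps(1)] by blast
    then show ?case
      using add.hyps(3) W
      by (intro bexI[of _ "a \<cdot>\<^sub>v c + c'"]) (auto simp: scalar_prod_add_distrib[OF W])
  qed
qed

section \<open>Degrees of the perception problems\<close>

lemma bipoly_h_rot:
  assumes "h \<in> set h_rot" "bipoly_vec n N 9 1 0 u"
  shows "bipoly n N 2 0 (\<lambda>p. h (unvec3 (u p)))"
proof -
  let ?c = "\<lambda>j p. col (unvec3 (u p)) j"
  have c: "bipoly_vec n N 3 1 0 (?c 0)" "bipoly_vec n N 3 1 0 (?c 1)" "bipoly_vec n N 3 1 0 (?c 2)"
    using assms(2) by (auto intro: bipoly_vec_col_unvec3)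
  have s: "bipoly n N 2 0 (\<lambda>p. v p \<bullet> w p)"
    if "bipoly_vec n N 3 1 0 v" "bipoly_vec n N 3 1 0 w" for v w
    by (rule bipoly_scalar_prod[OF that]) auto
  have q: "bipoly n N 2 0 (\<lambda>p. 1 - v p \<bullet> v p)" if "bipoly_vec n N 3 1 0 v" for v
    by (intro bipoly_diff bipoly_const s that)
  have x: "bipoly n N 2 0 (\<lambda>p. (cross (v p) (w p) - z p) $ i)"
    if "bipoly_vec n N 3 1 0 v" "bipoly_vec n N 3 1 0 w" "bipoly_vec n N 3 1 0 z" "i \<in> {0..<3}" for v w z i
    using that
    by (intro bipoly_vec_index[of n N 3] bipoly_vec_minus bipoly_vec_cross[of n N 1 0 _ 1 0])
      (auto intro: bipoly_vec_mono)
  show ?thesis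
    using assms(1) unfolding h_rot_def
    by (auto simp only: set_append set_map set_simps Un_iff insert_iff empty_iff set_upt
        intro!: s q x c)
qed

lemma bipoly_hx:
  assumes "h \<in> set (hx I)"
  shows "bipoly (x_dim I) N 2 0 (\<lambda>p. h (x_part I p))"
proof -
  have s: "bipoly n N 2 0 (\<lambda>p. v p \<bullet> w p)"
    if "bipoly_vec n N 3 1 0 v" "bipoly_vec n N 3 1 0 w" for n v w
    by (rule bipoly_scalar_prod[OF that]) auto
  show ?thesis
    using assms
    by (cases I) (auto simp: x_part_def intro!: bipoly_h_rot bipoly_diff s bipoly_vec_x
        bipoly_vec_first[OF bipoly_vec_x] bipoly_vec_last[OF bipoly_vec_x])
qed

lemma bipoly_gs:
  assumes "g \<in> set (gs I)"
  shows "bipoly (x_dim I) N 2 0 (\<lambda>p. g (x_part I p))"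
proof -
  have s: "bipoly n N 2 0 (\<lambda>p. v p \<bullet> w p)"
    if "bipoly_vec n N 3 1 0 v" "bipoly_vec n N 3 1 0 w" for n v w
    by (rule bipoly_scalar_prod[OF that]) auto
  show ?thesis
    using assms
    by (cases I) (auto simp: x_part_def intro!: bipoly_diff bipoly_add bipoly_divide bipoly_const s
        bipoly_vec_first[OF bipoly_vec_x] bipoly_vec_last[OF bipoly_vec_x])
qed

lemma bipoly_h\<theta>:
  assumes "h \<in> set (h\<theta> N)"
  shows "bipoly n N 2 2 (\<lambda>p. h (\<theta>_part N p))"
proof -
  obtain i where "h = (\<lambda>\<theta>. 1 - (\<theta> $ i)\<^sup>2)" "i < N"
    using assms by (auto simp: h\<theta>_def)
  then show ?thesis
    unfolding \<theta>_part_def power2_eq_square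
    by (auto intro!: bipoly_diff bipoly_const bipoly_mult[of n N 1 1 _ 1 1]
        bipoly_vec_index[OF bipoly_vec_\<theta>])
qed

lemma vec3_carrier: "R \<in> carrier_mat 3 3 \<Longrightarrow> vec3 R \<in> carrier_vec 9"
  by (rule carrier_vecI) (auto simp: vec3_def)

lemma bipoly_\<rho>:
  assumes "valid_data N I" "i < N"
  shows "bipoly (x_dim I) N 2 0 (\<lambda>p. \<rho> I i (x_part I p))"
proof -
  have c: "bipoly n N 2 0 (\<lambda>p. v \<bullet> w p)"
    if "v \<in> carrier_vec l" "bipoly_vec n N l 1 0 w" for n l v w
    by (rule bipoly_scalar_prod[OF bipoly_vec_const[OF that(1), of n N 0 0] that(2)]) auto
  \<comment> \<open>In contrast to \<open>c\<close>, this keeps the exact degree 1: the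
    point-to-plane residual of mesh registration is squared afterwards and must end at degree
    2.\<close>
  have c1: "bipoly n N 1 0 (\<lambda>p. v \<bullet> w p)"
    if "v \<in> carrier_vec l" "bipoly_vec n N l 1 0 w" for n l v w
    by (rule bipoly_scalar_prod[OF bipoly_vec_const[OF that(1), of n N 0 0] that(2)]) auto
  have s: "bipoly n N 2 0 (\<lambda>p. v p \<bullet> w p)"
    if "bipoly_vec n N l 1 0 v" "bipoly_vec n N l 1 0 w" for n l v w
    by (rule bipoly_scalar_prod[OF that]) auto
  have R: "bipoly_vec 12 N 3 1 0 (\<lambda>p. unvec3 (vec_first (vec_first p 12) 9) *\<^sub>v v)"
    if "v \<in> carrier_vec 3" for v
    by (rule bipoly_vec_unvec3_mult[OF bipoly_vec_first[OF bipoly_vec_x] that]) auto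
  have t: "bipoly_vec 12 N 3 1 0 (\<lambda>p. vec_last (vec_first p 12) 3)"
    by (rule bipoly_vec_last[OF bipoly_vec_x]) auto
  show ?thesis
  proof (cases I)
    case (RotationAveraging Rs)
    have v: "vec3 (Rs i) \<in> carrier_vec 9"
      using assms RotationAveraging by (intro vec3_carrier) (auto simp: SO3_def)
    then show ?thesis
      unfolding RotationAveraging x_part_def \<rho>.simps x_dim.simps
      by (intro bipoly_diff bipoly_const bipoly_cmult c[OF v bipoly_vec_x[OF order_refl]])
  next
    case (ShapeAlignment B b s')
    have d: "B i \<in> carrier_vec 3" "b i \<in> carrier_vec 2"
      using assms ShapeAlignment by auto
    have "bipoly_vec 6 N 2 1 0 (\<lambda>p. b i - mat_of_rows 3 [vec_first (vec_first p 6) 3,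
        vec_last (vec_first p 6) 3] *\<^sub>v B i)"
      by (intro bipoly_vec_minus bipoly_vec_const d bipoly_vec_two_rows_mult
          bipoly_vec_first[OF bipoly_vec_x] bipoly_vec_last[OF bipoly_vec_x]) auto
    from s[OF this this] show ?thesis
      unfolding ShapeAlignment x_part_def \<rho>.simps x_dim.simps Let_def .
  next
    case (PointCloudRegistration a b T)
    have d: "a i \<in> carrier_vec 3" "b i \<in> carrier_vec 3"
      using assms PointCloudRegistration by auto
    show ?thesis
      unfolding PointCloudRegistration x_part_def \<rho>.simps x_dim.simps Let_def
      by (intro bipoly_add bipoly_diff bipoly_const bipoly_cmult s[OF t t] c[OF d(2) t]
          c[OF d(2) R[OF d(1)]] s[OF t R[OF d(1)]])
  next
    case (MeshRegistration a b u v w T)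
    have d: "a i \<in> carrier_vec 3" "b i \<in> carrier_vec 3" "u i \<in> carrier_vec 3" "v i \<in> carrier_vec 3"
      using assms MeshRegistration by auto
    have "bipoly 12 N 1 0 (\<lambda>p. u i \<bullet> (unvec3 (vec_first (vec_first p 12) 9) *\<^sub>v b i) - u i \<bullet> a i
        - u i \<bullet> vec_last (vec_first p 12) 3)"
      by (intro bipoly_diff bipoly_const c1[OF d(3) R[OF d(2)]] c1[OF d(3) t])
    from bipoly_mult[OF this this] show ?thesis
      unfolding MeshRegistration x_part_def \<rho>.simps x_dim.simps Let_def power2_eq_square
      by (intro bipoly_add bipoly_diff bipoly_const bipoly_cmult c[OF d(3) R[OF d(4)]]) auto
  qed
qed

text \<open>Each summand is an affine function of one \<theta>-variable times the quadratic
  residual, plus another affine function of that variable, so its bidegree is at most (3, 1). The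
  bound (4, 2) is the one shared with the multiplier terms.\<close>

lemma bipoly_objective:
  assumes "valid_data N I"
  shows "bipoly (x_dim I) N 4 2 (objective N \<beta> c I)"
proof -
  have \<theta>: "bipoly (x_dim I) N 1 1 (\<lambda>p. \<theta>_part N p $ i)" if "i < N" for i
    unfolding \<theta>_part_def using that by (intro bipoly_vec_index[OF bipoly_vec_\<theta>]) auto
  have "bipoly (x_dim I) N 4 2 (\<lambda>p. (1 + \<theta>_part N p $ i) / (2 * (\<beta> i)\<^sup>2) * \<rho> I i (x_part I p)
            + (1 - \<theta>_part N p $ i) / 2 * c\<^sup>2)" if "i < N" for i
  proof (rule bipoly_add)
    show "bipoly (x_dim I) N 4 2 (\<lambda>p. (1 + \<theta>_part N p $ i) / (2 * (\<beta> i)\<^sup>2) * \<rho> I i (x_part I p))"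
      by (rule bipoly_mult[OF bipoly_divide[OF bipoly_add[OF bipoly_const \<theta>[OF that]]]
            bipoly_\<rho>[OF assms that]]) auto
    show "bipoly (x_dim I) N 4 2 (\<lambda>p. (1 - \<theta>_part N p $ i) / 2 * c\<^sup>2)"
      by (rule bipoly_mult[OF bipoly_divide[OF bipoly_diff[OF bipoly_const \<theta>[OF that]]]
            bipoly_const[of _ _ 0 0]]) auto
  qed
  then show ?thesis
    unfolding objective_def by (intro bipoly_sum) auto
qed

section \<open>The polynomial identity as a linear equation in d\<close>

definition multiplier_coeffs :: "nat \<Rightarrow> perception \<Rightarrow> real vec \<Rightarrow> real vec" where
  "multiplier_coeffs N I p =
     (concat_vecs (map (\<lambda>h. h (x_part I p) \<cdot>\<^sub>v monomials_le p 2) (hx I))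
      @\<^sub>v concat_vecs (map (\<lambda>h. h (\<theta>_part N p) \<cdot>\<^sub>v monomials_le (x_part I p) 2) (h\<theta> N)))
     @\<^sub>v concat_vecs (map (\<lambda>g. g (x_part I p) \<cdot>\<^sub>v svec (outer_prod (monomials_le p 1))) (gs I))"

definition gram_coeffs :: "nat \<Rightarrow> perception \<Rightarrow> real vec \<Rightarrow> real vec" where
  "gram_coeffs N I p = svec (outer_prod (basis_B (x_part I p) (\<theta>_part N p)))"

text \<open>All three kinds of products add up to (4, 2): an x-constraint contributes (2, 0) and its
  monomials in p (2, 2); a \<theta>-constraint contributes (2, 2) and its monomials in x (2, 0); an
  inequality contributes (2, 0) and the products of two entries of \<open>monomials_le p 1\<close>
  contribute (2, 2).\<close>

lemma bipoly_vec_multiplier_coeffs: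
  "bipoly_vec (x_dim I) N (block1_dim N I + block2_dim N I) 4 2 (multiplier_coeffs N I)"
proof -
  let ?n = "x_dim I"
  have p: "bipoly_vec ?n N (m_dim (p_dim N I) 2) 2 2 (\<lambda>p. monomials_le p 2)"
    using bipoly_monomials_le[OF bipoly_vec_self[of 1 1 ?n N], of 2] by (simp add: p_dim_def)
  have x: "bipoly_vec ?n N (m_dim ?n 2) 2 0 (\<lambda>p. monomials_le (x_part I p) 2)"
    using bipoly_monomials_le[OF bipoly_vec_x[of 1 ?n N 0], of 2] by (simp add: x_part_def)
  have q: "bipoly_vec ?n N (svec_dim (m_dim (p_dim N I) 1)) 2 2
      (\<lambda>p. svec (outer_prod (monomials_le p 1)))"
    using bipoly_vec_svec_outer_prod[OF bipoly_monomials_le[OF bipoly_vec_self[of 1 1 ?n N], of 1]]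
    by (simp add: p_dim_def numeral_2_eq_2)
  have "bipoly_vec ?n N (length (hx I) * m_dim (p_dim N I) 2) 4 2
      (\<lambda>p. concat_vecs (map (\<lambda>h. h (x_part I p) \<cdot>\<^sub>v monomials_le p 2) (hx I)))"
    by (rule bipoly_vec_concat_map, rule bipoly_vec_smult[OF bipoly_hx p]) simp_all
  moreover have "bipoly_vec ?n N (length (h\<theta> N) * m_dim ?n 2) 4 2
      (\<lambda>p. concat_vecs (map (\<lambda>h. h (\<theta>_part N p) \<cdot>\<^sub>v monomials_le (x_part I p) 2) (h\<theta> N)))"
    by (rule bipoly_vec_concat_map, rule bipoly_vec_smult[OF bipoly_h\<theta> x]) simp_all
  moreover have "bipoly_vec ?n N (length (gs I) * svec_dim (m_dim (p_dim N I) 1)) 4 2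
      (\<lambda>p. concat_vecs (map (\<lambda>g. g (x_part I p) \<cdot>\<^sub>v svec (outer_prod (monomials_le p 1))) (gs I)))"
    by (rule bipoly_vec_concat_map, rule bipoly_vec_smult[OF bipoly_gs q]) simp_all
  ultimately show ?thesis
    unfolding multiplier_coeffs_def block1_dim_def block2_dim_def
    by (intro bipoly_vec_append)
qed

lemma gram_coeffs_carrier:
  "gram_coeffs N I p \<in> carrier_vec (block3_dim N I)"
  by (rule carrier_vecI)
    (simp add: gram_coeffs_def dim_svec outer_prod_def dim_basis_B block3_dim_def x_part_def \<theta>_part_def)

text \<open>Once all unknowns stand on one side, the identity at p is linear in d, with coefficients
  depending only on p. Pairing the blocks gives the sums \<open>s1\<close>, \<open>s2\<close>,
  \<open>s3\<close> and the Gram term \<open>s0\<close>.\<close>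

lemma certificate_identity_iff:
  assumes "certificate_shape N I \<Lambda>x \<Lambda>\<theta> Ss S0"
  shows "certificate_identity N \<beta> c I fhat \<Lambda>x \<Lambda>\<theta> Ss S0 \<longleftrightarrow>
    (\<forall>p\<in>carrier_vec (p_dim N I). (multiplier_coeffs N I p @\<^sub>v gram_coeffs N I p) \<bullet>
       decision_vec \<Lambda>x \<Lambda>\<theta> Ss S0 = objective N \<beta> c I p - fhat)"
  unfolding certificate_identity_def Let_def
proof (intro ball_cong refl)
  fix p :: "real vec" assume p: "p \<in> carrier_vec (p_dim N I)"
  note sh = assms[unfolded certificate_shape_def]
  let ?x = "x_part I p" and ?\<theta> = "\<theta>_part N p"
  let ?m = "m_dim (p_dim N I) 2" and ?m' = "m_dim (x_dim I) 2" and ?m1 = "m_dim (p_dim N I) 1"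
  let ?q = "monomials_le p 1" and ?qB = "basis_B ?x ?\<theta>"
  have mp: "monomials_le p 2 \<in> carrier_vec ?m" and q: "?q \<in> carrier_vec ?m1"
    using p by (auto intro!: carrier_vecI simp: dim_monomials_le)
  have mx: "monomials_le ?x 2 \<in> carrier_vec ?m'"
    by (auto intro!: carrier_vecI simp: dim_monomials_le x_part_def)
  have qB: "?qB \<in> carrier_vec (mB_dim (x_dim I) N)"
    by (auto intro!: carrier_vecI simp: dim_basis_B x_part_def \<theta>_part_def)
  have sq: "svec (outer_prod ?q) \<in> carrier_vec (svec_dim ?m1)"
    using q by (auto intro!: carrier_vecI simp: dim_svec outer_prod_def)
  have Ss: "set (map svec Ss) \<subseteq> carrier_vec (svec_dim ?m1)"
    using sh by (fastforce intro!: carrier_vecI simp: dim_svec sym_mats_def)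
  let ?U1 = "map (\<lambda>h. h ?x \<cdot>\<^sub>v monomials_le p 2) (hx I)"
  let ?U2 = "map (\<lambda>h. h ?\<theta> \<cdot>\<^sub>v monomials_le ?x 2) (h\<theta> N)"
  let ?U3 = "map (\<lambda>g. g ?x \<cdot>\<^sub>v svec (outer_prod ?q)) (gs I)"
  have s1: "concat_vecs ?U1 \<bullet> concat_vecs \<Lambda>x
      = (\<Sum>j<length (hx I). (hx I ! j) ?x * (monomials_le p 2 \<bullet> (\<Lambda>x ! j)))"
  proof -
    have "concat_vecs ?U1 \<bullet> concat_vecs \<Lambda>x = (\<Sum>j<length \<Lambda>x. ?U1 ! j \<bullet> \<Lambda>x ! j)"
      using sh mp by (intro concat_vecs_scalar_prod[where l = ?m]) auto
    also have "\<dots> = (\<Sum>j<length (hx I). (hx I ! j) ?x * (monomials_le p 2 \<bullet> (\<Lambda>x ! j)))"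
      using sh by (intro sum.cong) (auto intro!: smult_scalar_prod_distrib[OF mp])
    finally show ?thesis .
  qed
  have s2: "concat_vecs ?U2 \<bullet> concat_vecs \<Lambda>\<theta>
      = (\<Sum>j<length (h\<theta> N). (h\<theta> N ! j) ?\<theta> * (monomials_le ?x 2 \<bullet> (\<Lambda>\<theta> ! j)))"
  proof -
    have "concat_vecs ?U2 \<bullet> concat_vecs \<Lambda>\<theta> = (\<Sum>j<length \<Lambda>\<theta>. ?U2 ! j \<bullet> \<Lambda>\<theta> ! j)"
      using sh mx by (intro concat_vecs_scalar_prod[where l = ?m']) auto
    also have "\<dots> = (\<Sum>j<length (h\<theta> N). (h\<theta> N ! j) ?\<theta> * (monomials_le ?x 2 \<bullet> (\<Lambda>\<theta> ! j)))"
      using sh by (intro sum.cong) (auto intro!: smult_scalar_prod_distrib[OF mx])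
    finally show ?thesis .
  qed
  have s3: "concat_vecs ?U3 \<bullet> concat_vecs (map svec Ss)
      = (\<Sum>k<length (gs I). (gs I ! k) ?x * (?q \<bullet> ((Ss ! k) *\<^sub>v ?q)))"
  proof -
    have "concat_vecs ?U3 \<bullet> concat_vecs (map svec Ss)
        = (\<Sum>k<length (map svec Ss). ?U3 ! k \<bullet> map svec Ss ! k)"
      using sh sq Ss by (intro concat_vecs_scalar_prod[where l = "svec_dim ?m1"]) auto
    also have "\<dots> = (\<Sum>k<length (gs I). (gs I ! k) ?x * (?q \<bullet> ((Ss ! k) *\<^sub>v ?q)))"
    proof (rule sum.cong)
      fix k assume k: "k \<in> {..<length (gs I)}"
      then have S: "Ss ! k \<in> sym_mats ?m1" "svec (Ss ! k) \<in> carrier_vec (svec_dim ?m1)"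
        using sh Ss by auto
      show "?U3 ! k \<bullet> map svec Ss ! k = (gs I ! k) ?x * (?q \<bullet> ((Ss ! k) *\<^sub>v ?q))"
        unfolding quadratic_form_eq_svec[OF S(1) q]
        using k sh smult_scalar_prod_distrib[OF sq S(2)] by simp
    qed (use sh in simp)
    finally show ?thesis .
  qed
  have s0: "gram_coeffs N I p \<bullet> svec S0 = ?qB \<bullet> (S0 *\<^sub>v ?qB)"
    unfolding gram_coeffs_def using sh by (intro quadratic_form_eq_svec[OF _ qB, symmetric]) blast
  let ?l1 = "length (hx I) * ?m" and ?l2 = "length (h\<theta> N) * ?m'"
  let ?l3 = "length (gs I) * svec_dim ?m1"
  have "set ?U1 \<subseteq> carrier_vec ?m" "set ?U2 \<subseteq> carrier_vec ?m'" "set ?U3 \<subseteq> carrier_vec (svec_dim ?m1)"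
    using mp mx sq by auto
  from this[THEN concat_vecs_carrier]
  have cU: "concat_vecs ?U1 \<in> carrier_vec ?l1" "concat_vecs ?U2 \<in> carrier_vec ?l2"
    "concat_vecs ?U3 \<in> carrier_vec ?l3"
    by (simp_all only: length_map)
  have cD: "concat_vecs \<Lambda>x \<in> carrier_vec ?l1" "concat_vecs \<Lambda>\<theta> \<in> carrier_vec ?l2"
    "concat_vecs (map svec Ss) \<in> carrier_vec ?l3"
    using concat_vecs_carrier[of \<Lambda>x ?m] concat_vecs_carrier[of \<Lambda>\<theta> ?m']
      concat_vecs_carrier[OF Ss] sh by auto
  have cS0: "svec S0 \<in> carrier_vec (block3_dim N I)"
    using sh by (auto intro!: carrier_vecI simp: dim_svec sym_mats_def block3_dim_def)
  \<comment> \<open>The blocks are regrouped to the left so that the nested appends match those of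
    the coefficient vector, and the scalar product splits block by block.\<close>
  have "decision_vec \<Lambda>x \<Lambda>\<theta> Ss S0
      = ((concat_vecs \<Lambda>x @\<^sub>v concat_vecs \<Lambda>\<theta>) @\<^sub>v concat_vecs (map svec Ss)) @\<^sub>v svec S0"
    by (simp add: decision_vec_def concat_vecs_append append_vec_assoc concat_vecs_single)
  then have "(multiplier_coeffs N I p @\<^sub>v gram_coeffs N I p) \<bullet> decision_vec \<Lambda>x \<Lambda>\<theta> Ss S0
      = concat_vecs ?U1 \<bullet> concat_vecs \<Lambda>x + concat_vecs ?U2 \<bullet> concat_vecs \<Lambda>\<theta>
        + concat_vecs ?U3 \<bullet> concat_vecs (map svec Ss) + gram_coeffs N I p \<bullet> svec S0"
    using cU cD cS0 gram_coeffs_carrier[of N I p]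
    by (simp add: multiplier_coeffs_def scalar_prod_append[of _ "?l1 + ?l2 + ?l3" _ "block3_dim N I"]
        scalar_prod_append[of _ "?l1 + ?l2" _ ?l3] scalar_prod_append[of _ ?l1 _ ?l2])
  then show "(objective N \<beta> c I p - fhat
          - (\<Sum>j<length (hx I). (hx I ! j) ?x * (monomials_le p 2 \<bullet> (\<Lambda>x ! j)))
          - (\<Sum>j<length (h\<theta> N). (h\<theta> N ! j) ?\<theta> * (monomials_le ?x 2 \<bullet> (\<Lambda>\<theta> ! j)))
        = ?qB \<bullet> (S0 *\<^sub>v ?qB) + (\<Sum>k<length (gs I). (gs I ! k) ?x * (?q \<bullet> ((Ss ! k) *\<^sub>v ?q))))
      = ((multiplier_coeffs N I p @\<^sub>v gram_coeffs N I p) \<bullet> decision_vec \<Lambda>x \<Lambda>\<theta> Ss S0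
        = objective N \<beta> c I p - fhat)"
    unfolding s0 s1 s2 s3 by auto
qed

section \<open>The cone and the certificates\<close>

lemma concat_vecs_combine:
  assumes "list_all2 (\<lambda>u v. dim_vec u = dim_vec v) us vs"
  shows "concat_vecs (map2 (\<lambda>u v. s \<cdot>\<^sub>v u + t \<cdot>\<^sub>v v) us vs)
    = s \<cdot>\<^sub>v concat_vecs us + t \<cdot>\<^sub>v concat_vecs vs"
proof -
  \<comment> \<open>The claim about dimensions is carried through the induction because vector sums
    of appended blocks split only when the blocks have equal lengths.\<close>
  have "concat_vecs (map2 (\<lambda>u v. s \<cdot>\<^sub>v u + t \<cdot>\<^sub>v v) us vs)
      = s \<cdot>\<^sub>v concat_vecs us + t \<cdot>\<^sub>v concat_vecs vs
    \<and> dim_vec (concat_vecs us) = dim_vec (concat_vecs vs)"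
    using assms
  proof (induction rule: list_all2_induct)
    case Nil
    show ?case by (auto simp: concat_vecs_def)
  next
    case (Cons u us v vs)
    have "(s \<cdot>\<^sub>v u + t \<cdot>\<^sub>v v) @\<^sub>v (s \<cdot>\<^sub>v concat_vecs us + t \<cdot>\<^sub>v concat_vecs vs)
        = s \<cdot>\<^sub>v (u @\<^sub>v concat_vecs us) + t \<cdot>\<^sub>v (v @\<^sub>v concat_vecs vs)"
      using Cons by (intro eq_vecI) auto
    with Cons show ?case by (simp add: concat_vecs_Cons)
  qed
  then show ?thesis ..
qed

lemma svec_combine:
  assumes "S \<in> carrier_mat m m" "T \<in> carrier_mat m m"
  shows "svec (s \<cdot>\<^sub>m S + t \<cdot>\<^sub>m T) = s \<cdot>\<^sub>v svec S + t \<cdot>\<^sub>v svec T"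
proof (rule eq_vecI)
  show "dim_vec (svec (s \<cdot>\<^sub>m S + t \<cdot>\<^sub>m T)) = dim_vec (s \<cdot>\<^sub>v svec S + t \<cdot>\<^sub>v svec T)"
    using assms by (simp add: dim_svec)
  fix r assume "r < dim_vec (s \<cdot>\<^sub>v svec S + t \<cdot>\<^sub>v svec T)"
  then have r: "r < svec_dim m" using assms by (simp add: dim_svec)
  have c: "s \<cdot>\<^sub>m S + t \<cdot>\<^sub>m T \<in> carrier_mat m m" using assms by simp
  obtain i j where ij: "svec_positions m ! r = (i, j)" by fastforce
  have "i < m" "j < m" by (rule svec_positions_less[OF r ij])+
  then show "svec (s \<cdot>\<^sub>m S + t \<cdot>\<^sub>m T) $ r = (s \<cdot>\<^sub>v svec S + t \<cdot>\<^sub>v svec T) $ r"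
    using assms r by (simp add: svec_index[OF _ r ij] dim_svec ring_distribs)
qed

text \<open>\<open>svec\<close> reads only the upper triangle, scaled by the nonzero factors 1 and
  \<open>sqrt 2\<close>; symmetry recovers the entries below the diagonal.\<close>

lemma svec_inj:
  assumes "S \<in> sym_mats m" "T \<in> sym_mats m" "svec S = svec T"
  shows "S = T"
proof -
  have c: "S \<in> carrier_mat m m" "T \<in> carrier_mat m m" and "S\<^sup>T = S" "T\<^sup>T = T"
    using assms by (auto simp: sym_mats_def)
  then have sym: "S $$ (j, i) = S $$ (i, j)" "T $$ (j, i) = T $$ (i, j)" if "i < m" "j < m" for i j
    using that by (metis carrier_matD index_transpose_mat(1))+
  have upper: "S $$ (i, j) = T $$ (i, j)" if "i \<le> j" "j < m" for i j
  proof -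
    have "(i, j) \<in> set (svec_positions m)" using that by (simp add: set_svec_positions)
    then obtain r where r: "r < svec_dim m" "svec_positions m ! r = (i, j)"
      by (auto simp: in_set_conv_nth length_svec_positions)
    then show ?thesis
      using svec_index[OF c(1) r] svec_index[OF c(2) r] assms(3) by (simp split: if_splits)
  qed
  show ?thesis
  proof (rule eq_matI)
    fix i j assume "i < dim_row T" "j < dim_col T"
    then have "i < m" "j < m" using c by auto
    then show "S $$ (i, j) = T $$ (i, j)"
      using upper[of i j] upper[of j i] sym[of i j] by (cases "i \<le> j") auto
  qed (use c in auto)
qed

text \<open>Equal lengths of corresponding components fix the cutting points.\<close>

lemma concat_vecs_inj:
  assumes "list_all2 (\<lambda>u v. dim_vec u = dim_vec v) us vs" "concat_vecs us = concat_vecs vs"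
  shows "us = vs"
  using assms
proof (induction rule: list_all2_induct)
  case (Cons u us v vs)
  then have "u = v \<and> concat_vecs us = concat_vecs vs"
    using append_vec_eq[OF carrier_vec_dim_vec carrier_vecI, of v u] by (simp add: concat_vecs_Cons)
  with Cons show ?case by simp
qed simp

lemma sym_mats_combine:
  assumes "S \<in> sym_mats m" "T \<in> sym_mats m"
  shows "s \<cdot>\<^sub>m S + t \<cdot>\<^sub>m T \<in> sym_mats m"
proof -
  have c: "S \<in> carrier_mat m m" "T \<in> carrier_mat m m" and "S\<^sup>T = S" "T\<^sup>T = T"
    using assms by (auto simp: sym_mats_def)
  then have sym: "S $$ (j, i) = S $$ (i, j)" "T $$ (j, i) = T $$ (i, j)" if "i < m" "j < m" for i j
    using that by (metis carrier_matD index_transpose_mat(1))+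
  have "(s \<cdot>\<^sub>m S + t \<cdot>\<^sub>m T)\<^sup>T = s \<cdot>\<^sub>m S + t \<cdot>\<^sub>m T"
    using c sym by (intro eq_matI) auto
  with c show ?thesis by (simp add: sym_mats_def)
qed

text \<open>For fixed v the quadratic form is linear in \<open>svec\<close> of the matrix, so it
  takes a nonnegative combination of nonnegative values.\<close>

lemma psd_mats_combine:
  assumes "S \<in> psd_mats m" "T \<in> psd_mats m" "s \<ge> 0" "t \<ge> 0"
  shows "s \<cdot>\<^sub>m S + t \<cdot>\<^sub>m T \<in> psd_mats m"
proof -
  have S: "S \<in> sym_mats m" "T \<in> sym_mats m" "S \<in> carrier_mat m m" "T \<in> carrier_mat m m"
    using assms by (auto simp: psd_mats_def sym_mats_def)
  have "v \<bullet> ((s \<cdot>\<^sub>m S + t \<cdot>\<^sub>m T) *\<^sub>v v) \<ge> 0" if v: "v \<in> carrier_vec m" for v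
  proof -
    have d: "svec M \<in> carrier_vec (svec_dim m)" if "M \<in> carrier_mat m m" for M
      using that by (intro carrier_vecI) (simp add: dim_svec)
    have o: "svec (outer_prod v) \<in> carrier_vec (svec_dim m)"
      using v by (intro carrier_vecI) (simp add: dim_svec outer_prod_def)
    have "v \<bullet> ((s \<cdot>\<^sub>m S + t \<cdot>\<^sub>m T) *\<^sub>v v) = s * (v \<bullet> (S *\<^sub>v v)) + t * (v \<bullet> (T *\<^sub>v v))"
      unfolding quadratic_form_eq_svec[OF sym_mats_combine[OF S(1,2)] v]
        quadratic_form_eq_svec[OF S(1) v] quadratic_form_eq_svec[OF S(2) v] svec_combine[OF S(3,4)]
      using d[OF S(3)] d[OF S(4)] o by (simp add: scalar_prod_add_distrib[OF o])
    with assms v show ?thesis by (simp add: psd_mats_def)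
  qed
  with sym_mats_combine[OF S(1,2)] show ?thesis by (simp add: psd_mats_def)
qed

lemma set_map2_closed:
  assumes "set xs \<subseteq> A" "set ys \<subseteq> A" "\<And>x y. x \<in> A \<Longrightarrow> y \<in> A \<Longrightarrow> f x y \<in> A"
  shows "set (map2 f xs ys) \<subseteq> A"
proof
  fix z assume "z \<in> set (map2 f xs ys)"
  then obtain x y where xy: "(x, y) \<in> set (zip xs ys)" "z = f x y" by auto
  then show "z \<in> A"
    using assms set_zip_leftD[OF xy(1)] set_zip_rightD[OF xy(1)] by blast
qed

lemma list_all2_same_dim:
  "length us = length vs \<Longrightarrow> set us \<subseteq> carrier_vec l \<Longrightarrow> set vs \<subseteq> carrier_vec l
    \<Longrightarrow> list_all2 (\<lambda>u v. dim_vec u = dim_vec v) us vs"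
  by (auto simp: list_all2_conv_all_nth subset_iff in_set_conv_nth) (metis carrier_vecD)

lemma svec_list_carrier:
  "set Ss \<subseteq> sym_mats m \<Longrightarrow> set (map svec Ss) \<subseteq> carrier_vec (svec_dim m)"
  by (fastforce intro!: carrier_vecI simp: dim_svec sym_mats_def)

lemma certificate_shape_same_dims:
  assumes "certificate_shape N I \<Lambda>x \<Lambda>\<theta> Ss S0" "certificate_shape N I \<Lambda>x' \<Lambda>\<theta>' Ss' S0'"
  shows "list_all2 (\<lambda>u v. dim_vec u = dim_vec v) (\<Lambda>x @ \<Lambda>\<theta> @ map svec Ss @ [svec S0])
      (\<Lambda>x' @ \<Lambda>\<theta>' @ map svec Ss' @ [svec S0'])"
proof -
  note sh = assms[unfolded certificate_shape_def]
  show ?thesis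
  proof (intro list_all2_appendI)
    show "list_all2 (\<lambda>u v. dim_vec u = dim_vec v) \<Lambda>x \<Lambda>x'"
      by (rule list_all2_same_dim[of _ _ "m_dim (p_dim N I) 2"]) (use sh in simp_all)
    show "list_all2 (\<lambda>u v. dim_vec u = dim_vec v) \<Lambda>\<theta> \<Lambda>\<theta>'"
      by (rule list_all2_same_dim[of _ _ "m_dim (x_dim I) 2"]) (use sh in simp_all)
    show "list_all2 (\<lambda>u v. dim_vec u = dim_vec v) (map svec Ss) (map svec Ss')"
      by (rule list_all2_same_dim[OF _ svec_list_carrier svec_list_carrier,
            of _ _ "m_dim (p_dim N I) 1"]) (use sh in simp_all)
    show "list_all2 (\<lambda>u v. dim_vec u = dim_vec v) [svec S0] [svec S0']"
      using sh by (auto simp: dim_svec sym_mats_def)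
  qed
qed

text \<open>This makes semidefiniteness a property of the decision vector itself: two data of the
  right shape with the same vector carry the same matrices.\<close>

lemma decision_vec_inj:
  assumes "certificate_shape N I \<Lambda>x \<Lambda>\<theta> Ss S0" "certificate_shape N I \<Lambda>x' \<Lambda>\<theta>' Ss' S0'"
    and "decision_vec \<Lambda>x \<Lambda>\<theta> Ss S0 = decision_vec \<Lambda>x' \<Lambda>\<theta>' Ss' S0'"
  shows "Ss = Ss' \<and> S0 = S0'"
proof -
  note sh = assms(1,2)[unfolded certificate_shape_def]
  have "\<Lambda>x @ \<Lambda>\<theta> @ map svec Ss @ [svec S0] = \<Lambda>x' @ \<Lambda>\<theta>' @ map svec Ss' @ [svec S0']"
    by (rule concat_vecs_inj[OF certificate_shape_same_dims[OF assms(1,2)]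
          assms(3)[unfolded decision_vec_def]])
  then have "map svec Ss = map svec Ss'" "svec S0 = svec S0'"
    using sh by auto
  moreover have "inj_on svec (set Ss \<union> set Ss')"
    by (rule inj_on_subset[of _ "sym_mats (m_dim (p_dim N I) 1)"]) (use sh in \<open>blast intro: inj_onI svec_inj\<close>)+
  moreover have "S0 \<in> sym_mats (mB_dim (x_dim I) N)" "S0' \<in> sym_mats (mB_dim (x_dim I) N)"
    using sh by blast+
  ultimately show ?thesis
    by (blast intro: map_inj_on svec_inj)
qed

text \<open>On data of one shape the decision vector is linear; a combination of vectors in the cone
  is thereby realised by explicit data.\<close>

lemma decision_vec_combine:
  assumes "certificate_shape N I \<Lambda>x \<Lambda>\<theta> Ss S0" "certificate_shape N I \<Lambda>x' \<Lambda>\<theta>' Ss' S0'"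
  shows "s \<cdot>\<^sub>v decision_vec \<Lambda>x \<Lambda>\<theta> Ss S0 + t \<cdot>\<^sub>v decision_vec \<Lambda>x' \<Lambda>\<theta>' Ss' S0'
    = decision_vec (map2 (\<lambda>u v. s \<cdot>\<^sub>v u + t \<cdot>\<^sub>v v) \<Lambda>x \<Lambda>x') (map2 (\<lambda>u v. s \<cdot>\<^sub>v u + t \<cdot>\<^sub>v v) \<Lambda>\<theta> \<Lambda>\<theta>')
        (map2 (\<lambda>S T. s \<cdot>\<^sub>m S + t \<cdot>\<^sub>m T) Ss Ss') (s \<cdot>\<^sub>m S0 + t \<cdot>\<^sub>m S0')"
proof -
  note sh = assms[unfolded certificate_shape_def]
  let ?f = "\<lambda>u v. s \<cdot>\<^sub>v u + t \<cdot>\<^sub>v v"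
  let ?m1 = "m_dim (p_dim N I) 1"
  have Ss: "map2 ?f (map svec Ss) (map svec Ss') = map svec (map2 (\<lambda>S T. s \<cdot>\<^sub>m S + t \<cdot>\<^sub>m T) Ss Ss')"
  proof (rule nth_equalityI)
    fix k assume "k < length (map2 ?f (map svec Ss) (map svec Ss'))"
    then have k: "k < length Ss" "k < length Ss'" by auto
    then have "Ss ! k \<in> sym_mats ?m1" "Ss' ! k \<in> sym_mats ?m1"
      using sh nth_mem[OF k(1)] nth_mem[OF k(2)] by blast+
    then have "Ss ! k \<in> carrier_mat ?m1 ?m1" "Ss' ! k \<in> carrier_mat ?m1 ?m1"
      by (simp_all add: sym_mats_def)
    with k show "map2 ?f (map svec Ss) (map svec Ss') ! k
        = map svec (map2 (\<lambda>S T. s \<cdot>\<^sub>m S + t \<cdot>\<^sub>m T) Ss Ss') ! k"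
      by (simp add: svec_combine)
  qed simp
  have S0: "S0 \<in> carrier_mat (mB_dim (x_dim I) N) (mB_dim (x_dim I) N)"
    "S0' \<in> carrier_mat (mB_dim (x_dim I) N) (mB_dim (x_dim I) N)"
    using sh by (auto simp: sym_mats_def)
  from concat_vecs_combine[OF certificate_shape_same_dims[OF assms]] show ?thesis
    unfolding decision_vec_def Ss[symmetric] svec_combine[OF S0] using sh by simp
qed

lemma certificate_shape_combine:
  assumes "certificate_shape N I \<Lambda>x \<Lambda>\<theta> Ss S0" "certificate_shape N I \<Lambda>x' \<Lambda>\<theta>' Ss' S0'"
  shows "certificate_shape N I
    (map2 (\<lambda>u v. s \<cdot>\<^sub>v u + t \<cdot>\<^sub>v v) \<Lambda>x \<Lambda>x') (map2 (\<lambda>u v. s \<cdot>\<^sub>v u + t \<cdot>\<^sub>v v) \<Lambda>\<theta> \<Lambda>\<theta>')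
    (map2 (\<lambda>S T. s \<cdot>\<^sub>m S + t \<cdot>\<^sub>m T) Ss Ss') (s \<cdot>\<^sub>m S0 + t \<cdot>\<^sub>m S0')"
  using assms unfolding certificate_shape_def
  by (intro conjI set_map2_closed) (simp_all add: sym_mats_combine)

lemma certificate_psd_combine:
  assumes "certificate_psd N I Ss S0" "certificate_psd N I Ss' S0'" "s \<ge> 0" "t \<ge> 0"
  shows "certificate_psd N I (map2 (\<lambda>S T. s \<cdot>\<^sub>m S + t \<cdot>\<^sub>m T) Ss Ss') (s \<cdot>\<^sub>m S0 + t \<cdot>\<^sub>m S0')"
  using assms unfolding certificate_psd_def
  by (intro conjI set_map2_closed) (simp_all add: psd_mats_combine)

lemma decision_vec_carrier:
  assumes "certificate_shape N I \<Lambda>x \<Lambda>\<theta> Ss S0"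
  shows "decision_vec \<Lambda>x \<Lambda>\<theta> Ss S0 \<in> carrier_vec (decision_dim N I)"
proof -
  note sh = assms[unfolded certificate_shape_def]
  have "set (map svec Ss) \<subseteq> carrier_vec (svec_dim (m_dim (p_dim N I) 1))"
    using sh by (intro svec_list_carrier) simp
  moreover have "svec S0 \<in> carrier_vec (block3_dim N I)"
    using sh by (auto intro!: carrier_vecI simp: dim_svec sym_mats_def block3_dim_def)
  ultimately show ?thesis
    using concat_vecs_carrier[of \<Lambda>x "m_dim (p_dim N I) 2"]
      concat_vecs_carrier[of \<Lambda>\<theta> "m_dim (x_dim I) 2"]
      concat_vecs_carrier[of "map svec Ss" "svec_dim (m_dim (p_dim N I) 1)"] sh
    by (auto intro!: carrier_vecI simp: decision_vec_def concat_vecs_append concat_vecs_single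
        decision_dim_def block1_dim_def block2_dim_def)
qed

lemma zero_psd_mats: "0\<^sub>m m m \<in> psd_mats m"
proof -
  have "0\<^sub>m m m *\<^sub>v v = 0\<^sub>v m" if "v \<in> carrier_vec m" for v :: "real vec"
    using that by (intro eq_vecI) auto
  then show ?thesis by (auto simp: psd_mats_def sym_mats_def)
qed

lemma sdp_cone_convex: "is_convex_cone (decision_dim N I) (sdp_cone N I)"
proof -
  \<comment> \<open>Closure under arbitrary nonnegative combinations, of which both scaling and
    convexity are instances.\<close>
  have comb: "s \<cdot>\<^sub>v v + t \<cdot>\<^sub>v w \<in> sdp_cone N I"
    if vw: "v \<in> sdp_cone N I" "w \<in> sdp_cone N I" and st: "s \<ge> 0" "t \<ge> 0" for v w s t
  proof -
    obtain \<Lambda>x \<Lambda>\<theta> Ss S0 \<Lambda>x' \<Lambda>\<theta>' Ss' S0' where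
      v: "v = decision_vec \<Lambda>x \<Lambda>\<theta> Ss S0" "certificate_shape N I \<Lambda>x \<Lambda>\<theta> Ss S0" "certificate_psd N I Ss S0" and
      w: "w = decision_vec \<Lambda>x' \<Lambda>\<theta>' Ss' S0'" "certificate_shape N I \<Lambda>x' \<Lambda>\<theta>' Ss' S0'" "certificate_psd N I Ss' S0'"
      using vw unfolding sdp_cone_def by blast
    show ?thesis
      unfolding sdp_cone_def mem_Collect_eq v(1) w(1) decision_vec_combine[OF v(2) w(2)]
      using certificate_shape_combine[OF v(2) w(2)] certificate_psd_combine[OF v(3) w(3) st] by blast
  qed
  have carrier: "sdp_cone N I \<subseteq> carrier_vec (decision_dim N I)"
    unfolding sdp_cone_def using decision_vec_carrier by blast
  have scale: "r \<cdot>\<^sub>v v \<in> sdp_cone N I" if "v \<in> sdp_cone N I" "r \<ge> 0" for v r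
  proof -
    have "r \<cdot>\<^sub>v v = r \<cdot>\<^sub>v v + 0 \<cdot>\<^sub>v v" by (rule eq_vecI) auto
    with comb[OF that(1) that(1) that(2), of 0] show ?thesis by simp
  qed
  have nonempty: "sdp_cone N I \<noteq> {}"
  proof -
    let ?Zs = "replicate (length (gs I)) (0\<^sub>m (m_dim (p_dim N I) 1) (m_dim (p_dim N I) 1))"
    let ?Z = "0\<^sub>m (mB_dim (x_dim I) N) (mB_dim (x_dim I) N)"
    have "certificate_shape N I (replicate (length (hx I)) (0\<^sub>v (m_dim (p_dim N I) 2)))
        (replicate (length (h\<theta> N)) (0\<^sub>v (m_dim (x_dim I) 2))) ?Zs ?Z"
      using zero_psd_mats by (auto simp: certificate_shape_def psd_mats_def)
    moreover have "certificate_psd N I ?Zs ?Z"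
      using zero_psd_mats by (auto simp: certificate_psd_def)
    ultimately show ?thesis unfolding sdp_cone_def by blast
  qed
  show ?thesis
    unfolding is_convex_cone_def
    by (intro conjI ballI allI impI nonempty carrier scale comb)
qed

section \<open>Lower bounds from certificates and the resulting feasibility problem\<close>

lemma certificate_lower_bound:
  assumes cert: "is_certificate N \<beta> c I fhat \<Lambda>x \<Lambda>\<theta> Ss S0" and p: "p \<in> feasible_set N I"
  shows "fhat \<le> objective N \<beta> c I p"
proof -
  let ?x = "x_part I p" and ?\<theta> = "\<theta>_part N p"
  let ?q = "monomials_le p 1" and ?qB = "basis_B ?x ?\<theta>"
  have sh: "certificate_shape N I \<Lambda>x \<Lambda>\<theta> Ss S0" and psd: "certificate_psd N I Ss S0"
    and id: "certificate_identity N \<beta> c I fhat \<Lambda>x \<Lambda>\<theta> Ss S0"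
    using cert by (auto simp: is_certificate_def)
  have pc: "p \<in> carrier_vec (p_dim N I)" using p by (simp add: feasible_set_def)
  have h: "(\<Sum>j<length (hx I). (hx I ! j) ?x * (monomials_le p 2 \<bullet> (\<Lambda>x ! j))) = 0"
    "(\<Sum>j<length (h\<theta> N). (h\<theta> N ! j) ?\<theta> * (monomials_le ?x 2 \<bullet> (\<Lambda>\<theta> ! j))) = 0"
    using p by (auto simp: feasible_set_def intro!: sum.neutral)
  have q: "?q \<in> carrier_vec (m_dim (p_dim N I) 1)" and qB: "?qB \<in> carrier_vec (mB_dim (x_dim I) N)"
    using pc by (auto intro!: carrier_vecI
        simp: dim_monomials_le dim_basis_B x_part_def \<theta>_part_def)
  have "0 \<le> (gs I ! k) ?x * (?q \<bullet> ((Ss ! k) *\<^sub>v ?q))" if "k < length (gs I)" for k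
  proof (rule mult_nonneg_nonneg)
    show "0 \<le> (gs I ! k) ?x" using p that by (auto simp: feasible_set_def)
    have "Ss ! k \<in> psd_mats (m_dim (p_dim N I) 1)"
      using psd sh that by (auto simp: certificate_psd_def certificate_shape_def)
    then show "0 \<le> ?q \<bullet> ((Ss ! k) *\<^sub>v ?q)" using q by (simp add: psd_mats_def)
  qed
  then have "0 \<le> (\<Sum>k<length (gs I). (gs I ! k) ?x * (?q \<bullet> ((Ss ! k) *\<^sub>v ?q)))"
    by (intro sum_nonneg) auto
  moreover have "0 \<le> ?qB \<bullet> (S0 *\<^sub>v ?qB)"
    using psd qB by (simp add: certificate_psd_def psd_mats_def)
  moreover have "objective N \<beta> c I p - fhat
      = ?qB \<bullet> (S0 *\<^sub>v ?qB) + (\<Sum>k<length (gs I). (gs I ! k) ?x * (?q \<bullet> ((Ss ! k) *\<^sub>v ?q)))"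
    using id[unfolded certificate_identity_def Let_def, rule_format, OF pc] h by simp
  ultimately show ?thesis by simp
qed

text \<open>A and b are fixed before the certificate data are quantified, so one linear system
  characterises the identity for all data of the right shape.\<close>

lemma certificate_identity_linear_system:
  assumes "valid_data N I"
  obtains A M b where "A \<in> carrier_mat M (decision_dim N I)" "b \<in> carrier_vec M"
    "partially_orthogonal (block1_dim N I) (block2_dim N I) (block3_dim N I) A"
    "\<And>\<Lambda>x \<Lambda>\<theta> Ss S0. certificate_shape N I \<Lambda>x \<Lambda>\<theta> Ss S0 \<Longrightarrow>
       certificate_identity N \<beta> c I fhat \<Lambda>x \<Lambda>\<theta> Ss S0 \<longleftrightarrow>
       decision_vec \<Lambda>x \<Lambda>\<theta> Ss S0 \<in> affine_space (decision_dim N I) A b"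
proof -
  let ?l = "block1_dim N I + block2_dim N I" and ?m = "block3_dim N I"
  let ?U = "multiplier_coeffs N I" and ?W = "gram_coeffs N I"
  let ?D = "carrier_vec (p_dim N I) :: real vec set" and ?F = "\<lambda>p. objective N \<beta> c I p - fhat"
  have U: "bipoly_vec (x_dim I) N ?l 4 2 ?U" by (rule bipoly_vec_multiplier_coeffs)
  have span: "\<exists>c\<in>carrier_vec ?m. \<forall>p\<in>?D. f p = ?W p \<bullet> c" if "bipoly (x_dim I) N 4 2 f" for f
    using bipoly_4_2_eq_svec[OF that]
    by (simp add: gram_coeffs_def block3_dim_def p_dim_def x_part_def \<theta>_part_def)
  have dim: "decision_dim N I = ?l + ?m" by (simp add: decision_dim_def)
  show ?thesis
  proof (rule obtain_orthogonal_linear_system[of ?D ?U ?l ?W ?m ?F])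
    show "?U p \<in> carrier_vec ?l" if "p \<in> ?D" for p
      using bipoly_vec_carrier[OF U] that by (simp add: p_dim_def)
    show "?W p \<in> carrier_vec ?m" for p by (rule gram_coeffs_carrier)
    show "\<exists>c\<in>carrier_vec ?m. \<forall>p\<in>?D. ?U p $ j = ?W p \<bullet> c" if "j < ?l" for j
      by (rule span[OF bipoly_vec_index[OF U that]])
    show "\<exists>c\<in>carrier_vec ?m. \<forall>p\<in>?D. ?F p = ?W p \<bullet> c"
      by (rule span[OF bipoly_diff[OF bipoly_objective[OF assms] bipoly_const]])
  next
    fix A M b
    assume A: "A \<in> carrier_mat M (?l + ?m)" "b \<in> carrier_vec M"
      "diagonal_mat (col_block A ?l ?m * (col_block A ?l ?m)\<^sup>T)"
      "invertible_mat (col_block A ?l ?m * (col_block A ?l ?m)\<^sup>T)"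
      and equiv: "\<And>d. d \<in> carrier_vec (?l + ?m) \<Longrightarrow>
        (\<forall>p\<in>?D. (?U p @\<^sub>v ?W p) \<bullet> d = ?F p) \<longleftrightarrow> A *\<^sub>v d = b"
    show thesis
    proof (rule that)
      show "A \<in> carrier_mat M (decision_dim N I)" "b \<in> carrier_vec M"
        unfolding dim by (fact A)+
      show "partially_orthogonal (block1_dim N I) (block2_dim N I) (block3_dim N I) A"
        unfolding partially_orthogonal_def Let_def using A by simp
      fix \<Lambda>x \<Lambda>\<theta> Ss S0 assume sh: "certificate_shape N I \<Lambda>x \<Lambda>\<theta> Ss S0"
      show "certificate_identity N \<beta> c I fhat \<Lambda>x \<Lambda>\<theta> Ss S0 \<longleftrightarrow>
         decision_vec \<Lambda>x \<Lambda>\<theta> Ss S0 \<in> affine_space (decision_dim N I) A b"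
        unfolding certificate_identity_iff[OF sh] affine_space_def mem_Collect_eq
        using equiv decision_vec_carrier[OF sh] by (simp only: dim simp_thms)
    qed
  qed
qed

theorem theorem8:
  fixes N :: nat and \<beta> :: "nat \<Rightarrow> real" and c :: real and I :: perception
    and phat :: "real vec" and fhat :: real
  assumes "N \<ge> 1" and "c > 0" and "\<And>i. i < N \<Longrightarrow> \<beta> i > 0" and "valid_data N I"
    and "phat \<in> feasible_set N I" and "fhat = objective N \<beta> c I phat"
  shows
    "((\<exists>\<Lambda>x \<Lambda>\<theta> Ss S0. is_certificate N \<beta> c I fhat \<Lambda>x \<Lambda>\<theta> Ss S0) \<longrightarrow>
        (fhat \<in> objective N \<beta> c I ` feasible_set N I \<and>
         (\<forall>p \<in> feasible_set N I. fhat \<le> objective N \<beta> c I p)) \<and>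
        is_arg_min (objective N \<beta> c I) (\<lambda>p. p \<in> feasible_set N I) phat)
     \<and>
     is_convex_cone (decision_dim N I) (sdp_cone N I)
     \<and>
     (\<exists>A M b. A \<in> carrier_mat M (decision_dim N I) \<and> b \<in> carrier_vec M \<and>
        partially_orthogonal (block1_dim N I) (block2_dim N I) (block3_dim N I) A \<and>
        (\<forall>\<Lambda>x \<Lambda>\<theta> Ss S0. certificate_shape N I \<Lambda>x \<Lambda>\<theta> Ss S0 \<longrightarrow>
           (certificate_psd N I Ss S0 \<longleftrightarrow> decision_vec \<Lambda>x \<Lambda>\<theta> Ss S0 \<in> sdp_cone N I) \<and>
           (certificate_identity N \<beta> c I fhat \<Lambda>x \<Lambda>\<theta> Ss S0 \<longleftrightarrow>
              decision_vec \<Lambda>x \<Lambda>\<theta> Ss S0 \<in> affine_space (decision_dim N I) A b)) \<and>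
        {decision_vec \<Lambda>x \<Lambda>\<theta> Ss S0 | \<Lambda>x \<Lambda>\<theta> Ss S0. is_certificate N \<beta> c I fhat \<Lambda>x \<Lambda>\<theta> Ss S0}
          = sdp_cone N I \<inter> affine_space (decision_dim N I) A b)"
proof (rule certificate_identity_linear_system[where \<beta> = \<beta> and c = c and fhat = fhat, OF assms(4)])
  fix A M b
  assume A: "A \<in> carrier_mat M (decision_dim N I)" "b \<in> carrier_vec M"
    "partially_orthogonal (block1_dim N I) (block2_dim N I) (block3_dim N I) A"
    and identity: "\<And>\<Lambda>x \<Lambda>\<theta> Ss S0. certificate_shape N I \<Lambda>x \<Lambda>\<theta> Ss S0 \<Longrightarrow>
       certificate_identity N \<beta> c I fhat \<Lambda>x \<Lambda>\<theta> Ss S0 \<longleftrightarrow>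
       decision_vec \<Lambda>x \<Lambda>\<theta> Ss S0 \<in> affine_space (decision_dim N I) A b"
  have psd: "certificate_psd N I Ss S0 \<longleftrightarrow> decision_vec \<Lambda>x \<Lambda>\<theta> Ss S0 \<in> sdp_cone N I"
    if sh: "certificate_shape N I \<Lambda>x \<Lambda>\<theta> Ss S0" for \<Lambda>x \<Lambda>\<theta> Ss S0
  proof
    show "certificate_psd N I Ss S0 \<Longrightarrow> decision_vec \<Lambda>x \<Lambda>\<theta> Ss S0 \<in> sdp_cone N I"
      unfolding sdp_cone_def using sh by blast
  next
    \<comment> \<open>Membership provides possibly different data with the same vector; injectivity
      identifies their matrices with the given ones.\<close>
    assume "decision_vec \<Lambda>x \<Lambda>\<theta> Ss S0 \<in> sdp_cone N I"
    then obtain \<Lambda>x' \<Lambda>\<theta>' Ss' S0' where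
      *: "decision_vec \<Lambda>x \<Lambda>\<theta> Ss S0 = decision_vec \<Lambda>x' \<Lambda>\<theta>' Ss' S0'"
        "certificate_shape N I \<Lambda>x' \<Lambda>\<theta>' Ss' S0'" "certificate_psd N I Ss' S0'"
      unfolding sdp_cone_def by blast
    from decision_vec_inj[OF sh *(2,1)] *(3) show "certificate_psd N I Ss S0" by simp
  qed
  have feasible: "{decision_vec \<Lambda>x \<Lambda>\<theta> Ss S0 | \<Lambda>x \<Lambda>\<theta> Ss S0. is_certificate N \<beta> c I fhat \<Lambda>x \<Lambda>\<theta> Ss S0}
      = sdp_cone N I \<inter> affine_space (decision_dim N I) A b" (is "?L = ?R")
  proof (intro equalityI subsetI)
    fix d assume "d \<in> ?L"
    then obtain \<Lambda>x \<Lambda>\<theta> Ss S0 where d: "d = decision_vec \<Lambda>x \<Lambda>\<theta> Ss S0"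
      and cert: "is_certificate N \<beta> c I fhat \<Lambda>x \<Lambda>\<theta> Ss S0" by blast
    then have sh: "certificate_shape N I \<Lambda>x \<Lambda>\<theta> Ss S0" by (simp add: is_certificate_def)
    with cert show "d \<in> ?R"
      unfolding d is_certificate_def psd[OF sh] identity[OF sh] by simp
  next
    \<comment> \<open>Being in the cone already supplies data of the right shape with semidefinite
      matrices; the affine condition adds the identity for these same data.\<close>
    fix d assume d: "d \<in> ?R"
    then obtain \<Lambda>x \<Lambda>\<theta> Ss S0 where *: "d = decision_vec \<Lambda>x \<Lambda>\<theta> Ss S0"
        "certificate_shape N I \<Lambda>x \<Lambda>\<theta> Ss S0" "certificate_psd N I Ss S0"
      unfolding sdp_cone_def by blast
    then have "is_certificate N \<beta> c I fhat \<Lambda>x \<Lambda>\<theta> Ss S0"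
      using d identity[OF *(2)] by (simp add: is_certificate_def)
    with *(1) show "d \<in> ?L" by blast
  qed
  have sdp: "\<exists>A M b. A \<in> carrier_mat M (decision_dim N I) \<and> b \<in> carrier_vec M \<and>
        partially_orthogonal (block1_dim N I) (block2_dim N I) (block3_dim N I) A \<and>
        (\<forall>\<Lambda>x \<Lambda>\<theta> Ss S0. certificate_shape N I \<Lambda>x \<Lambda>\<theta> Ss S0 \<longrightarrow>
           (certificate_psd N I Ss S0 \<longleftrightarrow> decision_vec \<Lambda>x \<Lambda>\<theta> Ss S0 \<in> sdp_cone N I) \<and>
           (certificate_identity N \<beta> c I fhat \<Lambda>x \<Lambda>\<theta> Ss S0 \<longleftrightarrow>
              decision_vec \<Lambda>x \<Lambda>\<theta> Ss S0 \<in> affine_space (decision_dim N I) A b)) \<and>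
        {decision_vec \<Lambda>x \<Lambda>\<theta> Ss S0 | \<Lambda>x \<Lambda>\<theta> Ss S0. is_certificate N \<beta> c I fhat \<Lambda>x \<Lambda>\<theta> Ss S0}
          = sdp_cone N I \<inter> affine_space (decision_dim N I) A b"
    by (intro exI[of _ A] exI[of _ M] exI[of _ b] conjI allI impI A feasible psd identity)
  have minimum: "(fhat \<in> objective N \<beta> c I ` feasible_set N I \<and>
         (\<forall>p \<in> feasible_set N I. fhat \<le> objective N \<beta> c I p)) \<and>
        is_arg_min (objective N \<beta> c I) (\<lambda>p. p \<in> feasible_set N I) phat"
    if cert: "is_certificate N \<beta> c I fhat \<Lambda>x \<Lambda>\<theta> Ss S0" for \<Lambda>x \<Lambda>\<theta> Ss S0
  proof -
    have "\<forall>p \<in> feasible_set N I. fhat \<le> objective N \<beta> c I p"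
      using certificate_lower_bound[OF cert] by blast
    with assms(5,6) show ?thesis by (auto simp: is_arg_min_def not_less)
  qed
  show ?thesis
    by (rule conjI[OF _ conjI[OF sdp_cone_convex sdp]], rule impI, elim exE, rule minimum)
qed

end
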